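(* For every $d\ge1$ and $L\ge4$, \[ M_{d,L}\in\mathcal H_d\setminus\mathcal H_{d+1}. \] Hence the sequence $(\mathcal H_d)_{d\ge1}$ is strictly decreasing, i.e. $\mathcal H_{d+1}\subsetneq\mathcal H_d$ for all $d\geq 1$.
   Context: $\mathbb Z^d$ acts on $2^{\mathbb Z^d}$ by $(g\cdot x)(u)=x(u+g)$; $X_d=\mathrm{Free}(2^{\mathbb Z^d})$ is the set of $x$ with trivial stabilizer. The standard Schreier graph $F(2^{\mathbb Z^d})$ on $X_d$ joins $x$ to $e_i\cdot x$, $1\le i\le d$. $\mathcal H_d$ is the set of finite simple graphs $H$ for which there is a continuous map $c:X_d\to V(H)$ ($V(H)$ discrete) taking adjacent points to adjacent vertices. Definition of $M_{d,L}$ (for integers $d\ge1$, $L\ge4$): put $Q=[-2L,2L]^d\cap\mathbb Z^d$ and $S_d=\{\pm e_1,\dots,\pm e_d\}$. The vertices of $M_{d,L}$ are the subsets $D\subseteq Q$ whose distinct points have sup-distance greater than $L$ and such that every point of $[-L,L]^d\cap\mathbb Z^d$ is within sup-distance $L$ of some point of $D$. Two vertices $D,E$ are adjacent when for some $g\in S_d$ one has $D\cap(g+Q)=(g+E)\cap Q$. *)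

theory Defs
  imports "HOL-Analysis.Analysis" "HOL-Library.Function_Algebras"
    "Graph_Theory.Pair_Digraph"
begin

text \<open>
  The dimension varies within the theorem, so \<open>\<int>\<^sup>d\<close> cannot be a type. It is represented by the
  integer sequences vanishing from index \<open>d\<close> on; addition, negation and \<open>0\<close> are the pointwise
  ones of \<^theory>\<open>HOL-Library.Function_Algebras\<close>. Coordinates are numbered \<open>0, \<dots>, d - 1\<close>.
\<close>

definition lattice_Z :: "nat \<Rightarrow> (nat \<Rightarrow> int) set" where
  "lattice_Z d = {u. \<forall>i\<ge>d. u i = 0}"

definition unit_vec :: "nat \<Rightarrow> nat \<Rightarrow> int" where
  "unit_vec i = (\<lambda>j. if j = i then 1 else 0)"

text \<open>For \<open>d = 0\<close> this is the unspecified value of \<open>Max {}\<close>; only \<open>d \<ge> 1\<close> is used.\<close>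

definition sup_dist :: "nat \<Rightarrow> (nat \<Rightarrow> int) \<Rightarrow> (nat \<Rightarrow> int) \<Rightarrow> int" where
  "sup_dist d u v = (MAX i\<in>{..<d}. \<bar>u i - v i\<bar>)"

definition cube :: "nat \<Rightarrow> int \<Rightarrow> (nat \<Rightarrow> int) set" where
  "cube d r = {u \<in> lattice_Z d. \<forall>i<d. u i \<in> {-r..r}}"

text \<open>
  The topological space \<open>2\<^bsup>\<int>\<^sup>d\<^esup>\<close>. Its points are the functions on \<^term>\<open>lattice_Z d\<close> that are
  \<^const>\<open>undefined\<close> elsewhere.
\<close>

definition Cantor_Z :: "nat \<Rightarrow> ((nat \<Rightarrow> int) \<Rightarrow> bool) topology" where
  "Cantor_Z d = product_topology (\<lambda>_. discrete_topology UNIV) (lattice_Z d)"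

definition shift :: "nat \<Rightarrow> (nat \<Rightarrow> int) \<Rightarrow> ((nat \<Rightarrow> int) \<Rightarrow> bool) \<Rightarrow> ((nat \<Rightarrow> int) \<Rightarrow> bool)" where
  "shift d g x = (\<lambda>u\<in>lattice_Z d. x (u + g))"

definition Free :: "nat \<Rightarrow> ((nat \<Rightarrow> int) \<Rightarrow> bool) set" where
  "Free d = {x \<in> topspace (Cantor_Z d). \<forall>g\<in>lattice_Z d. shift d g x = x \<longrightarrow> g = 0}"

text \<open>Undirected graphs are symmetric digraphs: an edge is a pair of opposite arcs.\<close>

definition Schreier :: "nat \<Rightarrow> ((nat \<Rightarrow> int) \<Rightarrow> bool) pair_pre_digraph" where
  "Schreier d = \<lparr> pverts = Free d,
     parcs = {(x, y). x \<in> Free d \<and> y \<in> Free d \<and>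
       (\<exists>i<d. y = shift d (unit_vec i) x \<or> x = shift d (unit_vec i) y)} \<rparr>"

text \<open>
  \<^const>\<open>pair_graph\<close> is the predicate of finite simple graphs (finite, symmetric, loop-free).
  The class is polymorphic in the type of the vertices.
\<close>

definition HH :: "nat \<Rightarrow> 'a pair_pre_digraph set" where
  "HH d = {H. pair_graph H \<and>
     (\<exists>c. continuous_map (subtopology (Cantor_Z d) (Free d)) (discrete_topology (pverts H)) c \<and>
       (\<forall>(x, y)\<in>parcs (Schreier d). (c x, c y) \<in> parcs H))}"

definition M_verts :: "nat \<Rightarrow> int \<Rightarrow> (nat \<Rightarrow> int) set set" where
  "M_verts d L = {D. D \<subseteq> cube d (2 * L) \<and>
     (\<forall>p\<in>D. \<forall>q\<in>D. p \<noteq> q \<longrightarrow> sup_dist d p q > L) \<and>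
     (\<forall>u\<in>cube d L. \<exists>p\<in>D. sup_dist d u p \<le> L)}"

definition gens :: "nat \<Rightarrow> (nat \<Rightarrow> int) set" where
  "gens d = (\<Union>i<d. {unit_vec i, - unit_vec i})"

definition M_graph :: "nat \<Rightarrow> int \<Rightarrow> (nat \<Rightarrow> int) set pair_pre_digraph" where
  "M_graph d L = (let Q = cube d (2 * L) in
     \<lparr> pverts = M_verts d L,
       parcs = {(D, E). D \<in> M_verts d L \<and> E \<in> M_verts d L \<and>
         (\<exists>g\<in>gens d. D \<inter> (+) g ` Q = (+) g ` E \<inter> Q)} \<rparr>)"

end

theory Submission
  imports Defs
begin

text \<open>
  Membership in \<open>\<H>\<^sub>d\<close>: the free part carries a clopen maximal \<open>L\<close>-discrete set \<open>A\<close>, and a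
  configuration \<open>x\<close> is coloured by the trace on \<open>Q\<close> of the net \<open>{u. u \<cdot> x \<in> A}\<close>.

  Non-membership in \<open>\<H>\<^bsub>d+1\<^esub>\<close>: since \<open>L \<ge> 4\<close>, a colouring \<open>c\<close> by \<open>M\<^bsub>d,L\<^esub>\<close> induces a \<open>\<int>\<^sup>d\<close>-valued cocycle
  whose steps are unit vectors, by recording how the net moves. Evaluate it on uniformly aperiodic configurations,
  over which \<open>c\<close> has a uniform window, that contain a large box tiled with period \<open>p\<close> in all
  directions and, next to it, a region tiled with period \<open>q = p - 1\<close>. Comparing the two around a
  rectangle of length \<open>p q\<close> shows that the cocycle over \<open>p\<close> steps is divisible by \<open>p\<close>; as \<open>p\<close> is odd, it
  is \<open>p\<close> times a unit vector, and all steps in one direction agree. Two of the \<open>d + 1\<close> directions are then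
  parallel. The tile repeats one pattern at distance \<open>(p - 1) / 2\<close>, so some translation has a net
  displacement of one unit vector although it carries a position to another one with the same window: a net would
  contain two points at distance 1.
\<close>

section \<open>Finitary colourings of the free part\<close>

lemma lattice_Z_add: "u \<in> lattice_Z d \<Longrightarrow> v \<in> lattice_Z d \<Longrightarrow> u + v \<in> lattice_Z d"
  and lattice_Z_diff: "u \<in> lattice_Z d \<Longrightarrow> v \<in> lattice_Z d \<Longrightarrow> u - v \<in> lattice_Z d"
  and lattice_Z_uminus: "u \<in> lattice_Z d \<Longrightarrow> - u \<in> lattice_Z d"
  and lattice_Z_zero: "0 \<in> lattice_Z d"
  and lattice_Z_unit_vec: "i < d \<Longrightarrow> unit_vec i \<in> lattice_Z d"
  by (auto simp: lattice_Z_def unit_vec_def)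

lemmas lattice_Z_intros = lattice_Z_add lattice_Z_diff lattice_Z_uminus lattice_Z_zero
  lattice_Z_unit_vec

lemma cube_subset_lattice_Z: "cube d r \<subseteq> lattice_Z d"
  by (auto simp: cube_def)

lemma cubeI: "u \<in> lattice_Z d \<Longrightarrow> (\<And>i. i < d \<Longrightarrow> \<bar>u i\<bar> \<le> r) \<Longrightarrow> u \<in> cube d r"
  by (force simp: cube_def)

lemma cube_abs_le: "u \<in> cube d r \<Longrightarrow> i < d \<Longrightarrow> \<bar>u i\<bar> \<le> r"
  by (force simp: cube_def)

lemma cube_mono: "r \<le> s \<Longrightarrow> cube d r \<subseteq> cube d s"
  by (force simp: cube_def)

lemma finite_cube [simp]: "finite (cube d r)"
proof (rule finite_subset)
  show "cube d r \<subseteq> {f. \<forall>i. (i \<in> {..<d} \<longrightarrow> f i \<in> {-r..r}) \<and> (i \<notin> {..<d} \<longrightarrow> f i = 0)}"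
    by (auto simp: cube_def lattice_Z_def)
  show "finite {f :: nat \<Rightarrow> int. \<forall>i. (i \<in> {..<d} \<longrightarrow> f i \<in> {-r..r}) \<and> (i \<notin> {..<d} \<longrightarrow> f i = 0)}"
    by (rule finite_set_of_finite_funs) auto
qed

lemma finite_subset_cube:
  assumes "finite F" "F \<subseteq> lattice_Z d"
  obtains r where "r \<ge> 0" "F \<subseteq> cube d r"
proof -
  define r where "r = (\<Sum>u\<in>F. \<Sum>i<d. \<bar>u i\<bar>)"
  have "\<bar>u i\<bar> \<le> r" if "u \<in> F" "i < d" for u i
  proof -
    have "\<bar>u i\<bar> \<le> (\<Sum>i<d. \<bar>u i\<bar>)" using that by (intro member_le_sum) auto
    also have "\<dots> \<le> r" unfolding r_def
      using that assms by (intro member_le_sum[of u F "\<lambda>u. \<Sum>i<d. \<bar>u i\<bar>"]) (auto intro: sum_nonneg)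
    finally show ?thesis .
  qed
  moreover have "r \<ge> 0" unfolding r_def by (intro sum_nonneg) auto
  ultimately show ?thesis using assms by (intro that[of r]) (auto intro!: cubeI)
qed

lemma sup_dist_le_iff: "d \<ge> 1 \<Longrightarrow> sup_dist d u v \<le> r \<longleftrightarrow> (\<forall>i<d. \<bar>u i - v i\<bar> \<le> r)"
  unfolding sup_dist_def by (subst Max_le_iff) (auto simp: lessThan_empty_iff)

lemma countable_lattice_Z: "countable (lattice_Z d)"
proof (rule countable_subset)
  show "lattice_Z d \<subseteq> (\<Union>r::int. cube d r)"
  proof
    fix u assume "u \<in> lattice_Z d"
    then show "u \<in> (\<Union>r::int. cube d r)" using finite_subset_cube[of "{u}" d] by auto
  qed
  show "countable (\<Union>r::int. cube d r)"
    by (rule countable_UN) (simp_all add: countable_finite)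
qed

section \<open>The shift action and the topology of the configuration space\<close>

lemma topspace_Cantor_Z: "topspace (Cantor_Z d) = extensional (lattice_Z d)"
  by (auto simp: Cantor_Z_def PiE_def)

lemma shift_apply: "u \<in> lattice_Z d \<Longrightarrow> shift d g x u = x (u + g)"
  by (simp add: shift_def)

lemma shift_extensional: "shift d g x \<in> extensional (lattice_Z d)"
  by (simp add: shift_def)

lemma shift_shift: "g \<in> lattice_Z d \<Longrightarrow> shift d g (shift d h x) = shift d (g + h) x"
  by (auto simp: shift_def fun_eq_iff restrict_def lattice_Z_intros add.assoc)

lemma shift_zero: "x \<in> extensional (lattice_Z d) \<Longrightarrow> shift d 0 x = x"
  by (auto simp: shift_def fun_eq_iff restrict_def extensional_def)

lemma Free_iff:
  "x \<in> Free d \<longleftrightarrow> x \<in> extensional (lattice_Z d) \<and>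
    (\<forall>g\<in>lattice_Z d. g \<noteq> 0 \<longrightarrow> (\<exists>u\<in>lattice_Z d. x (u + g) \<noteq> x u))"
proof -
  have "shift d g x = x \<longleftrightarrow> (\<forall>u\<in>lattice_Z d. x (u + g) = x u)"
    if "x \<in> extensional (lattice_Z d)" for g
    using that by (auto simp: shift_def fun_eq_iff restrict_def extensional_def)
  then show ?thesis unfolding Free_def topspace_Cantor_Z by auto
qed

lemma shift_Free: assumes "x \<in> Free d" "g \<in> lattice_Z d" shows "shift d g x \<in> Free d"
  unfolding Free_iff
proof (intro conjI ballI impI)
  fix h assume h: "h \<in> lattice_Z d" "h \<noteq> 0"
  obtain u where u: "u \<in> lattice_Z d" "x (u + h) \<noteq> x u"
    using assms h unfolding Free_iff by blast
  show "\<exists>u\<in>lattice_Z d. shift d g x (u + h) \<noteq> shift d g x u"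
    by (rule bexI[of _ "u - g"]) (use u assms h in \<open>auto simp: shift_apply lattice_Z_intros algebra_simps\<close>)
qed (rule shift_extensional)

text \<open>Cylinders, which fix finitely many coordinates, form a base of a product of discrete
  spaces. \<open>S\<close> is arbitrary because both the free part and the full space occur.\<close>

lemma openin_Cantor_Z_iff:
  assumes S: "S \<subseteq> extensional (lattice_Z d)"
  shows "openin (subtopology (Cantor_Z d) S) U \<longleftrightarrow> U \<subseteq> S \<and>
    (\<forall>x\<in>U. \<exists>F. finite F \<and> F \<subseteq> lattice_Z d \<and> (\<forall>y\<in>S. (\<forall>u\<in>F. y u = x u) \<longrightarrow> y \<in> U))"
proof (intro iffI conjI ballI)
  assume "openin (subtopology (Cantor_Z d) S) U"
  then obtain T where T: "openin (Cantor_Z d) T" "U = T \<inter> S" unfolding openin_subtopology by blast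
  then show "U \<subseteq> S" by auto
  fix x assume "x \<in> U"
  then obtain V where V: "finite {i \<in> lattice_Z d. V i \<noteq> UNIV}" "x \<in> PiE (lattice_Z d) V"
      "PiE (lattice_Z d) V \<subseteq> T"
    using T unfolding Cantor_Z_def openin_product_topology_alt by fastforce
  show "\<exists>F. finite F \<and> F \<subseteq> lattice_Z d \<and> (\<forall>y\<in>S. (\<forall>u\<in>F. y u = x u) \<longrightarrow> y \<in> U)"
  proof (intro exI[of _ "{i \<in> lattice_Z d. V i \<noteq> UNIV}"] conjI ballI impI)
    fix y assume y: "y \<in> S" "\<forall>u\<in>{i \<in> lattice_Z d. V i \<noteq> UNIV}. y u = x u"
    have "y i \<in> V i" if "i \<in> lattice_Z d" for i
      using y(2) V(2) that by (cases "V i = UNIV") (auto simp: PiE_iff)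
    then have "y \<in> PiE (lattice_Z d) V" using S y(1) by (auto simp: PiE_iff)
    then show "y \<in> U" using V T y by auto
  qed (use V in auto)
next
  assume R: "U \<subseteq> S \<and>
    (\<forall>x\<in>U. \<exists>F. finite F \<and> F \<subseteq> lattice_Z d \<and> (\<forall>y\<in>S. (\<forall>u\<in>F. y u = x u) \<longrightarrow> y \<in> U))"
  show "openin (subtopology (Cantor_Z d) S) U"
  proof (subst openin_subopen, intro ballI)
    fix x assume x: "x \<in> U"
    then obtain F where F: "finite F" "F \<subseteq> lattice_Z d" "\<forall>y\<in>S. (\<forall>u\<in>F. y u = x u) \<longrightarrow> y \<in> U"
      using R by blast
    define T where "T = PiE (lattice_Z d) (\<lambda>u. if u \<in> F then {x u} else UNIV)"
    have "openin (Cantor_Z d) T"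
      unfolding T_def Cantor_Z_def openin_PiE_gen
      by (intro disjI2 conjI finite_subset[OF _ F(1)]) auto
    moreover have "x \<in> T" using x R S by (auto simp: T_def PiE_iff)
    moreover have "T \<inter> S \<subseteq> U"
    proof
      fix y assume "y \<in> T \<inter> S"
      then have y: "y \<in> S" "y \<in> T" by auto
      have "y u = x u" if "u \<in> F" for u
        using PiE_mem[OF y(2)[unfolded T_def], of u] that F(2) by auto
      then show "y \<in> U" using y F(3) by blast
    qed
    ultimately show "\<exists>T. openin (subtopology (Cantor_Z d) S) T \<and> x \<in> T \<and> T \<subseteq> U"
      using x R by (intro exI[of _ "T \<inter> S"]) (auto simp: openin_subtopology)
  qed
qed

text \<open>Continuity into a discrete space is local constancy, hence dependence on a finite window
  \<open>F\<close>, which may vary with \<open>x\<close>.\<close>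

lemma continuous_map_Cantor_Z_iff:
  assumes S: "S \<subseteq> extensional (lattice_Z d)"
  shows "continuous_map (subtopology (Cantor_Z d) S) (discrete_topology V) c \<longleftrightarrow> c \<in> S \<rightarrow> V \<and>
    (\<forall>x\<in>S. \<exists>F. finite F \<and> F \<subseteq> lattice_Z d \<and> (\<forall>y\<in>S. (\<forall>u\<in>F. y u = x u) \<longrightarrow> c y = c x))"
proof -
  have top: "topspace (subtopology (Cantor_Z d) S) = S"
    using S by (auto simp: topspace_Cantor_Z)
  show ?thesis
  proof (intro iffI conjI ballI)
    assume c: "continuous_map (subtopology (Cantor_Z d) S) (discrete_topology V) c"
    then show cV: "c \<in> S \<rightarrow> V" using continuous_map_funspace top by fastforce
    fix x assume x: "x \<in> S"
    have "openin (subtopology (Cantor_Z d) S) {y \<in> S. c y \<in> {c x}}"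
      using openin_continuous_map_preimage[OF c, of "{c x}"] cV x unfolding top by auto
    then obtain F where "finite F" "F \<subseteq> lattice_Z d"
      "\<forall>y\<in>S. (\<forall>u\<in>F. y u = x u) \<longrightarrow> y \<in> {y \<in> S. c y \<in> {c x}}"
      unfolding openin_Cantor_Z_iff[OF S] using x by (elim conjE) (drule bspec[of _ _ x], simp, blast)
    then show "\<exists>F. finite F \<and> F \<subseteq> lattice_Z d \<and> (\<forall>y\<in>S. (\<forall>u\<in>F. y u = x u) \<longrightarrow> c y = c x)"
      by blast
  next
    assume R: "c \<in> S \<rightarrow> V \<and>
      (\<forall>x\<in>S. \<exists>F. finite F \<and> F \<subseteq> lattice_Z d \<and> (\<forall>y\<in>S. (\<forall>u\<in>F. y u = x u) \<longrightarrow> c y = c x))"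
    show "continuous_map (subtopology (Cantor_Z d) S) (discrete_topology V) c"
      unfolding continuous_map_def top
    proof (intro conjI allI impI)
      fix U assume "openin (discrete_topology V) U"
      show "openin (subtopology (Cantor_Z d) S) {x \<in> S. c x \<in> U}"
        unfolding openin_Cantor_Z_iff[OF S]
      proof (intro conjI ballI)
        fix x assume x: "x \<in> {x \<in> S. c x \<in> U}"
        then obtain F where F: "finite F" "F \<subseteq> lattice_Z d" "\<forall>y\<in>S. (\<forall>u\<in>F. y u = x u) \<longrightarrow> c y = c x"
          using R by blast
        have "y \<in> {x \<in> S. c x \<in> U}" if "y \<in> S" "\<forall>u\<in>F. y u = x u" for y
          using that F(3) x by (metis (mono_tags, lifting) mem_Collect_eq)
        with F(1,2) show "\<exists>F. finite F \<and> F \<subseteq> lattice_Z d \<and>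
            (\<forall>y\<in>S. (\<forall>u\<in>F. y u = x u) \<longrightarrow> y \<in> {x \<in> S. c x \<in> U})"
          by blast
      qed auto
    qed (use R in auto)
  qed
qed

lemma Free_extensional: "Free d \<subseteq> extensional (lattice_Z d)"
  by (auto simp: Free_iff)

lemma HH_iff:
  "H \<in> HH d \<longleftrightarrow> pair_graph H \<and> (\<exists>c. c \<in> Free d \<rightarrow> pverts H \<and>
    (\<forall>x\<in>Free d. \<exists>F. finite F \<and> F \<subseteq> lattice_Z d \<and> (\<forall>y\<in>Free d. (\<forall>u\<in>F. y u = x u) \<longrightarrow> c y = c x)) \<and>
    (\<forall>x\<in>Free d. \<forall>i<d. (c x, c (shift d (unit_vec i) x)) \<in> parcs H))"
proof -
  \<comment> \<open>The Schreier graph has each arc in both orientations; since \<open>H\<close> is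
    symmetric, the orientation given by \<open>unit_vec i\<close> suffices.\<close>
  have *: "(\<forall>(x, y)\<in>parcs (Schreier d). (c x, c y) \<in> parcs H) \<longleftrightarrow>
      (\<forall>x\<in>Free d. \<forall>i<d. (c x, c (shift d (unit_vec i) x)) \<in> parcs H)" if "pair_graph H" for c
  proof -
    interpret pair_graph H by fact
    have sym: "(b, a) \<in> parcs H" if "(a, b) \<in> parcs H" for a b
      using pair_sym_arcs that by (auto simp: symmetric_def sym_def)
    have "(x, shift d (unit_vec i) x) \<in> parcs (Schreier d)" if "x \<in> Free d" "i < d" for x i
      using that by (auto simp: Schreier_def shift_Free lattice_Z_intros)
    moreover have "(c x, c y) \<in> parcs H"
      if "\<forall>x\<in>Free d. \<forall>i<d. (c x, c (shift d (unit_vec i) x)) \<in> parcs H"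
        "(x, y) \<in> parcs (Schreier d)" for x y
      using that sym unfolding Schreier_def by auto
    ultimately show ?thesis by blast
  qed
  show ?thesis
    unfolding HH_def continuous_map_Cantor_Z_iff[OF Free_extensional] mem_Collect_eq conj_assoc
    by (cases "pair_graph H") (simp_all only: * simp_thms)
qed

section \<open>Maps determined locally by finitely many coordinates\<close>

definition finitary :: "nat \<Rightarrow> (((nat \<Rightarrow> int) \<Rightarrow> bool) \<Rightarrow> 'b) \<Rightarrow> bool" where
  "finitary d c \<longleftrightarrow> (\<forall>x\<in>Free d. \<exists>F. finite F \<and> F \<subseteq> lattice_Z d \<and>
     (\<forall>y\<in>Free d. (\<forall>u\<in>F. y u = x u) \<longrightarrow> c y = c x))"

lemma finitaryE:
  assumes "finitary d c" "x \<in> Free d"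
  obtains F where "finite F" "F \<subseteq> lattice_Z d"
    "\<And>y. y \<in> Free d \<Longrightarrow> (\<And>u. u \<in> F \<Longrightarrow> y u = x u) \<Longrightarrow> c y = c x"
proof -
  obtain F where F: "finite F" "F \<subseteq> lattice_Z d" "\<forall>y\<in>Free d. (\<forall>u\<in>F. y u = x u) \<longrightarrow> c y = c x"
    using bspec[OF assms(1)[unfolded finitary_def] assms(2)] by (elim exE conjE)
  show ?thesis
    using F(3) by (intro that[OF F(1,2)]) blast
qed

lemma finitaryI:
  assumes "\<And>x. x \<in> Free d \<Longrightarrow> \<exists>F. finite F \<and> F \<subseteq> lattice_Z d \<and>
     (\<forall>y\<in>Free d. (\<forall>u\<in>F. y u = x u) \<longrightarrow> c y = c x)"
  shows "finitary d c"
  using assms unfolding finitary_def by blast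

lemma finitary_const: "finitary d (\<lambda>_. a)"
  unfolding finitary_def by (intro ballI exI[of _ "{}"]) simp

lemma finitary_combine:
  assumes f: "finitary d f" and g: "finitary d g"
  shows "finitary d (\<lambda>x. h (f x) (g x))"
proof (rule finitaryI)
  fix x assume x: "x \<in> Free d"
  obtain F where F: "finite F" "F \<subseteq> lattice_Z d"
    "\<And>y. y \<in> Free d \<Longrightarrow> (\<And>u. u \<in> F \<Longrightarrow> y u = x u) \<Longrightarrow> f y = f x"
    using finitaryE[OF f x] by blast
  obtain G where G: "finite G" "G \<subseteq> lattice_Z d"
    "\<And>y. y \<in> Free d \<Longrightarrow> (\<And>u. u \<in> G \<Longrightarrow> y u = x u) \<Longrightarrow> g y = g x"
    using finitaryE[OF g x] by blast
  have "h (f y) (g y) = h (f x) (g x)" if "y \<in> Free d" "\<forall>u\<in>F \<union> G. y u = x u" for y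
    using F(3)[OF that(1)] G(3)[OF that(1)] that(2) by (metis UnI1 UnI2)
  then show "\<exists>F. finite F \<and> F \<subseteq> lattice_Z d \<and>
     (\<forall>y\<in>Free d. (\<forall>u\<in>F. y u = x u) \<longrightarrow> h (f y) (g y) = h (f x) (g x))"
    using F(1,2) G(1,2) by (intro exI[of _ "F \<union> G"]) blast
qed

lemma finitary_Collect:
  assumes "finite I" "\<And>i. i \<in> I \<Longrightarrow> finitary d (P i)"
  shows "finitary d (\<lambda>x. {i \<in> I. P i x})"
  using assms
proof (induction I rule: finite_induct)
  case empty
  then show ?case using finitary_const by simp
next
  case (insert i I)
  have "finitary d (\<lambda>x. (if P i x then insert i else id) {i \<in> I. P i x})"
    using insert by (intro finitary_combine[where h = "\<lambda>b. (if b then insert i else id)"]) auto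
  moreover have "(\<lambda>x. {j \<in> insert i I. P j x}) = (\<lambda>x. (if P i x then insert i else id) {i \<in> I. P i x})"
    by (auto simp: fun_eq_iff)
  ultimately show ?case by simp
qed

lemma finitary_shift:
  assumes c: "finitary d c" and g: "g \<in> lattice_Z d"
  shows "finitary d (\<lambda>x. c (shift d g x))"
proof (rule finitaryI)
  fix x assume x: "x \<in> Free d"
  obtain F where F: "finite F" "F \<subseteq> lattice_Z d"
    "\<And>y. y \<in> Free d \<Longrightarrow> (\<And>u. u \<in> F \<Longrightarrow> y u = shift d g x u) \<Longrightarrow> c y = c (shift d g x)"
    using finitaryE[OF c shift_Free[OF x g]] by blast
  have "c (shift d g y) = c (shift d g x)"
    if y: "y \<in> Free d" "\<forall>u\<in>(\<lambda>u. u + g) ` F. y u = x u" for y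
    using F(2) y(2) by (intro F(3) shift_Free y(1) g) (auto simp: shift_apply)
  then show "\<exists>F. finite F \<and> F \<subseteq> lattice_Z d \<and>
     (\<forall>y\<in>Free d. (\<forall>u\<in>F. y u = x u) \<longrightarrow> c (shift d g y) = c (shift d g x))"
    using F(1,2) g by (intro exI[of _ "(\<lambda>u. u + g) ` F"]) (auto simp: lattice_Z_intros)
qed

lemma finitary_eval: "u \<in> lattice_Z d \<Longrightarrow> finitary d (\<lambda>x. x u)"
  by (intro finitaryI exI[of _ "{u}"]) auto

lemma HH_iff_finitary:
  "H \<in> HH d \<longleftrightarrow> pair_graph H \<and> (\<exists>c. c \<in> Free d \<rightarrow> pverts H \<and> finitary d c \<and>
    (\<forall>x\<in>Free d. \<forall>i<d. (c x, c (shift d (unit_vec i) x)) \<in> parcs H))"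
  unfolding HH_iff finitary_def ..

section \<open>Graph homomorphisms and relabelling of vertices\<close>

lemma HH_hom:
  assumes H: "H \<in> HH d" and H': "pair_graph H'"
    and verts: "\<And>v. v \<in> pverts H \<Longrightarrow> h v \<in> pverts H'"
    and arcs: "\<And>v w. (v, w) \<in> parcs H \<Longrightarrow> (h v, h w) \<in> parcs H'"
  shows "H' \<in> HH d"
proof -
  obtain c where c: "c \<in> Free d \<rightarrow> pverts H" "finitary d c"
    "\<forall>x\<in>Free d. \<forall>i<d. (c x, c (shift d (unit_vec i) x)) \<in> parcs H"
    using H unfolding HH_iff_finitary by blast
  show ?thesis
    unfolding HH_iff_finitary
  proof (intro conjI exI[of _ "\<lambda>x. h (c x)"] ballI allI impI H' Pi_I)
    show "finitary d (\<lambda>x. h (c x))"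
      using finitary_combine[OF c(2,2), where h = "\<lambda>a _. h a"] by simp
  qed (use c verts arcs in auto)
qed

text \<open>Each instance of \<open>HH d\<close> has one fixed vertex type. Relabelled copies carry
  the graph of local nets over to any infinite type.\<close>

definition image_graph :: "('a \<Rightarrow> 'b) \<Rightarrow> 'a pair_pre_digraph \<Rightarrow> 'b pair_pre_digraph" where
  "image_graph h H = \<lparr>pverts = h ` pverts H, parcs = map_prod h h ` parcs H\<rparr>"

lemma pair_graph_image_graph:
  assumes "pair_graph H" and h: "inj_on h (pverts H)"
  shows "pair_graph (image_graph h H)"
proof -
  interpret pair_graph H by fact
  have wf: "v \<in> pverts H" "w \<in> pverts H" if "(v, w) \<in> parcs H" for v w
    using that by (auto intro: in_arcsD1 in_arcsD2)
  have sym: "(w, v) \<in> parcs H" if "(v, w) \<in> parcs H" for v w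
    using pair_sym_arcs that by (auto simp: symmetric_def sym_def)
  have irr: "v \<noteq> w" if "(v, w) \<in> parcs H" for v w
    using pair_no_loops[OF that] by simp
  show ?thesis
  proof
    show "fst e \<noteq> snd e" if e: "e \<in> parcs (image_graph h H)" for e
    proof -
      obtain v w where vw: "e = (h v, h w)" "(v, w) \<in> parcs H"
        using e by (auto simp: image_graph_def)
      then show ?thesis using irr[OF vw(2)] wf[OF vw(2)] h by (auto dest: inj_onD)
    qed
    have "(b, a) \<in> parcs (image_graph h H)" if ab: "(a, b) \<in> parcs (image_graph h H)" for a b
    proof -
      obtain v w where "a = h v" "b = h w" "(v, w) \<in> parcs H"
        using ab by (auto simp: image_graph_def)
      then show ?thesis using sym[of v w] by (force simp: image_graph_def)
    qed
    then show "symmetric (image_graph h H)"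
      by (auto simp: symmetric_def intro: symI)
  qed (auto simp: image_graph_def wf pair_finite_verts pair_finite_arcs)
qed

text \<open>Both \<open>h\<close> and its inverse on the vertices are homomorphisms, so
  \<open>HH_hom\<close> applies in either direction.\<close>

lemma image_graph_in_HH_iff:
  assumes H: "pair_graph H" and h: "inj_on h (pverts H)"
  shows "image_graph h H \<in> HH d \<longleftrightarrow> H \<in> HH d"
proof
  interpret pair_graph H by fact
  have wf: "v \<in> pverts H" "w \<in> pverts H" if "(v, w) \<in> parcs H" for v w
    using that by (auto intro: in_arcsD1 in_arcsD2)
  show "H \<in> HH d" if "image_graph h H \<in> HH d"
  proof (rule HH_hom[OF that H])
    show "inv_into (pverts H) h v \<in> pverts H" if "v \<in> pverts (image_graph h H)" for v
      using that by (auto simp: image_graph_def inv_into_into)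
    show "(inv_into (pverts H) h v, inv_into (pverts H) h w) \<in> parcs H"
      if vw: "(v, w) \<in> parcs (image_graph h H)" for v w
    proof -
      obtain a b where "v = h a" "w = h b" "(a, b) \<in> parcs H"
        using vw by (auto simp: image_graph_def)
      then show ?thesis using h wf by simp
    qed
  qed
  show "image_graph h H \<in> HH d" if "H \<in> HH d"
    by (rule HH_hom[OF that pair_graph_image_graph[OF H h], where h = h])
      (force simp: image_graph_def)+
qed

section \<open>Clopen maximal discrete sets\<close>

text \<open>The classes \<open>U k\<close> are processed in turn, and a point joins unless a
  neighbour was chosen at an earlier stage. Points of one class do not block each other, so the
  classes themselves must be independent.\<close>

primrec greedy :: "(nat \<Rightarrow> 'a set) \<Rightarrow> ('a \<Rightarrow> 'a set) \<Rightarrow> nat \<Rightarrow> 'a set" where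
  "greedy U N 0 = {}"
| "greedy U N (Suc k) = greedy U N k \<union> {x \<in> U k. N x \<inter> greedy U N k = {}}"

lemma greedy_mono: "j \<le> k \<Longrightarrow> greedy U N j \<subseteq> greedy U N k"
  by (induction rule: dec_induct) auto

lemma greedy_stage:
  assumes "x \<in> greedy U N k"
  obtains j where "j < k" "x \<in> U j" "N x \<inter> greedy U N j = {}"
  using assms by (induction k) (auto simp: less_Suc_eq)

lemma greedy_independent:
  assumes x: "x \<in> greedy U N k" and y: "y \<in> greedy U N m" and xy: "y \<in> N x" "x \<in> N y"
  obtains j where "x \<in> U j" "y \<in> U j"
proof -
  obtain i where i: "x \<in> U i" "N x \<inter> greedy U N i = {}" using greedy_stage[OF x] by blast
  obtain j where j: "y \<in> U j" "N y \<inter> greedy U N j = {}" using greedy_stage[OF y] by blast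
  have stage: "z \<in> greedy U N (Suc l)" if "z \<in> U l" "N z \<inter> greedy U N l = {}" for z l
    using that by simp
  have "\<not> i < j"
    using stage[OF i] greedy_mono[of "Suc i" j U N] j(2) xy(2) by (auto simp: Suc_le_eq)
  moreover have "\<not> j < i"
    using stage[OF j] greedy_mono[of "Suc j" i U N] i(2) xy(1) by (auto simp: Suc_le_eq)
  ultimately show ?thesis using i j that by (metis linorder_neqE_nat)
qed

text \<open>A pattern is a radius together with its set of ones. It contradicts each of its small
  nonzero translates already inside its own cube, so it cannot be seen from two orbit points that
  differ by a small translation.\<close>

definition rigid_pattern :: "nat \<Rightarrow> int \<Rightarrow> int \<times> (nat \<Rightarrow> int) set \<Rightarrow> bool" where
  "rigid_pattern d L = (\<lambda>(r, p). p \<subseteq> cube d r \<and> (\<forall>g\<in>cube d L. g \<noteq> 0 \<longrightarrow>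
     (\<exists>u\<in>cube d r. u + g \<in> cube d r \<and> (u + g \<in> p) \<noteq> (u \<in> p))))"

definition shows_pattern :: "nat \<Rightarrow> int \<times> (nat \<Rightarrow> int) set \<Rightarrow> ((nat \<Rightarrow> int) \<Rightarrow> bool) \<Rightarrow> bool" where
  "shows_pattern d = (\<lambda>(r, p) x. {u \<in> cube d r. x u} = p)"

lemma countable_rigid_patterns: "countable {rp. rigid_pattern d L rp}"
proof (rule countable_subset)
  show "{rp. rigid_pattern d L rp} \<subseteq> UNIV \<times> {p. finite p \<and> p \<subseteq> lattice_Z d}"
    by (auto simp: rigid_pattern_def intro: finite_subset[OF _ finite_cube]
        dest: subsetD[OF cube_subset_lattice_Z])
qed (intro countable_SIGMA countable_Collect_finite_subset countable_lattice_Z, simp)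

text \<open>Freeness yields a disagreement for each of the finitely many \<open>g\<close>; any cube
  containing all these positions and their translates will do.\<close>

lemma ex_rigid_pattern:
  assumes x: "x \<in> Free d"
  shows "\<exists>rp. rigid_pattern d L rp \<and> shows_pattern d rp x"
proof -
  have "\<forall>g\<in>cube d L - {0}. \<exists>u\<in>lattice_Z d. x (u + g) \<noteq> x u"
    using x cube_subset_lattice_Z unfolding Free_iff by blast
  then obtain w where w: "\<And>g. g \<in> cube d L - {0} \<Longrightarrow> w g \<in> lattice_Z d \<and> x (w g + g) \<noteq> x (w g)"
    by metis
  let ?F = "w ` (cube d L - {0}) \<union> (\<lambda>g. w g + g) ` (cube d L - {0})"
  have "finite ?F" by simp
  moreover have "?F \<subseteq> lattice_Z d"
    using w cube_subset_lattice_Z by (auto intro!: lattice_Z_add)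
  ultimately obtain r where r: "?F \<subseteq> cube d r" using finite_subset_cube[of ?F d] by blast
  have "rigid_pattern d L (r, {u \<in> cube d r. x u})"
    unfolding rigid_pattern_def split
  proof (intro conjI ballI impI)
    fix g assume g: "g \<in> cube d L" "g \<noteq> 0"
    then show "\<exists>u\<in>cube d r. u + g \<in> cube d r \<and>
        (u + g \<in> {u \<in> cube d r. x u}) \<noteq> (u \<in> {u \<in> cube d r. x u})"
      using w[of g] r by (intro bexI[of _ "w g"]) auto
  qed auto
  then show ?thesis by (intro exI[of _ "(r, {u \<in> cube d r. x u})"]) (auto simp: shows_pattern_def)
qed

lemma finitary_shows_pattern: "finitary d (shows_pattern d rp)"
proof -
  obtain r p where rp: "rp = (r, p)" by fastforce
  have "finitary d (\<lambda>x. {u \<in> cube d r. x u} = p)"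
    using cube_subset_lattice_Z
    by (intro finitary_combine[OF finitary_Collect finitary_const] finitary_eval) auto
  then show ?thesis by (simp add: rp shows_pattern_def)
qed

lemma rigid_pattern_unique:
  assumes rp: "rigid_pattern d L rp" "shows_pattern d rp x" "shows_pattern d rp (shift d g x)"
    and g: "g \<in> cube d L"
  shows "g = 0"
proof (rule ccontr)
  assume "g \<noteq> 0"
  obtain r p where [simp]: "rp = (r, p)" by fastforce
  obtain u where u: "u \<in> cube d r" "u + g \<in> cube d r" "(u + g \<in> p) \<noteq> (u \<in> p)"
    using rp(1) g \<open>g \<noteq> 0\<close> unfolding rigid_pattern_def by auto
  have "u \<in> p \<longleftrightarrow> shift d g x u" "u + g \<in> p \<longleftrightarrow> x (u + g)"
    using rp(2,3) u(1,2) unfolding shows_pattern_def by auto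
  moreover have "shift d g x u = x (u + g)"
    by (intro shift_apply subsetD[OF cube_subset_lattice_Z u(1)])
  ultimately show False using u(3) by simp
qed

text \<open>The configurations showing a given rigid pattern form a clopen class without two points
  at distance at most \<open>L\<close> in an orbit. Countably many such classes cover the free part,
  and the greedy set over them is maximal discrete.\<close>

lemma ex_maximal_discrete:
  assumes L: "L \<ge> 0"
  obtains A where "A \<subseteq> Free d" "finitary d (\<lambda>x. x \<in> A)"
    "\<And>x g. x \<in> A \<Longrightarrow> shift d g x \<in> A \<Longrightarrow> g \<in> cube d L \<Longrightarrow> g = 0"
    "\<And>x. x \<in> Free d \<Longrightarrow> \<exists>g\<in>cube d L. shift d g x \<in> A"
proof -
  define I where "I = {rp. rigid_pattern d L rp}"
  define U where "U = (\<lambda>k. {x \<in> Free d. \<exists>rp\<in>I. to_nat_on I rp = k \<and> shows_pattern d rp x})"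
  define N where "N = (\<lambda>x. (\<lambda>g. shift d g x) ` cube d L)"
  define A where "A = (\<Union>k. greedy U N k)"
  have cubeD: "g \<in> lattice_Z d" if "g \<in> cube d L" for g using that cube_subset_lattice_Z by auto
  have cube0: "0 \<in> cube d L" using L by (auto intro!: cubeI lattice_Z_zero)
  have inj: "inj_on (to_nat_on I) I"
    unfolding I_def by (intro inj_on_to_nat_on countable_rigid_patterns)
  \<comment> \<open>The numbering is injective on patterns, so \<open>U k\<close> belongs to a
    single pattern or is empty.\<close>
  have finU: "finitary d (\<lambda>x. x \<in> U k)" for k
  proof (cases "\<exists>rp\<in>I. to_nat_on I rp = k")
    case True
    then obtain rp where rp: "rp \<in> I" "to_nat_on I rp = k" by blast
    have "x \<in> U k \<longleftrightarrow> shows_pattern d rp x" if "x \<in> Free d" for x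
      using rp inj that by (auto simp: U_def inj_on_def)
    then show ?thesis
      using finitary_shows_pattern[of d rp] unfolding finitary_def by simp
  qed (use finitary_const[of d False] in \<open>auto simp: U_def\<close>)
  have Ugreedy: "greedy U N k \<subseteq> Free d" for k
    by (induction k) (auto simp: U_def)
  have finG: "finitary d (\<lambda>x. x \<in> greedy U N k)" for k
  proof (induction k)
    case 0
    then show ?case using finitary_const by simp
  next
    case (Suc k)
    have "finitary d (\<lambda>x. {g \<in> cube d L. shift d g x \<in> greedy U N k} = {})"
      by (intro finitary_combine[OF finitary_Collect finitary_const] finitary_shift[OF Suc] finite_cube cubeD)
    from finitary_combine[OF Suc finitary_combine[OF finU[of k] this, where h = "(\<and>)"], where h = "(\<or>)"]
    show ?case by (rule back_subst[of "finitary d"]) (auto simp: N_def fun_eq_iff)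
  qed
  have sep: "g = 0" if x: "x \<in> A" and y: "shift d g x \<in> A" and g: "g \<in> cube d L" for x g
  proof -
    have xF: "x \<in> Free d" using x Ugreedy by (auto simp: A_def)
    have "- g \<in> cube d L" using g by (auto simp: cube_def lattice_Z_def)
    moreover have x0: "shift d 0 x = x" using xF by (simp add: shift_zero Free_iff)
    ultimately have "x \<in> N (shift d g x)"
      using g x0 by (auto simp: N_def shift_shift cubeD image_iff intro!: bexI[of _ "-g"])
    moreover have "shift d g x \<in> N x" using g by (auto simp: N_def)
    ultimately obtain j where j: "x \<in> U j" "shift d g x \<in> U j"
      using x y unfolding A_def by (auto elim: greedy_independent)
    then obtain rp where "rp \<in> I" "shows_pattern d rp x" "shows_pattern d rp (shift d g x)"
      using inj by (auto simp: U_def inj_on_def)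
    then show ?thesis using rigid_pattern_unique g by (auto simp: I_def)
  qed
  have cover: "\<exists>k. x \<in> U k" if "x \<in> Free d" for x
    using ex_rigid_pattern[OF that, of L] that by (auto simp: U_def I_def)
  \<comment> \<open>If the blocking element is \<open>x\<close> itself, the case
    \<open>g = 0\<close>, then \<open>x\<close> was chosen before and is still present.\<close>
  have dich: "x \<in> greedy U N (Suc k) \<or> (\<exists>g\<in>cube d L. g \<noteq> 0 \<and> shift d g x \<in> greedy U N k)"
    if "x \<in> U k" for x k
  proof -
    have x0: "shift d 0 x = x" using that by (simp add: U_def shift_zero Free_iff)
    show ?thesis
    proof (cases "N x \<inter> greedy U N k = {}")
      case False
      then obtain g where "g \<in> cube d L" "shift d g x \<in> greedy U N k" by (auto simp: N_def)
      then show ?thesis using x0 by (cases "g = 0") auto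
    qed (use that in simp)
  qed
  \<comment> \<open>This makes the infinite union \<open>A\<close> clopen: on \<open>U k\<close> the
    decision is final after stage \<open>k\<close>, since a point blocked there has a neighbour in
    \<open>A\<close> and can never enter.\<close>
  have stage: "x \<in> A \<longleftrightarrow> x \<in> greedy U N (Suc k)" if "x \<in> U k" for x k
  proof
    assume "x \<in> A"
    then show "x \<in> greedy U N (Suc k)" using dich[OF that] sep unfolding A_def by blast
  qed (auto simp: A_def simp del: greedy.simps)
  show ?thesis
  proof (rule that)
    show "A \<subseteq> Free d" using Ugreedy by (auto simp: A_def)
    show "finitary d (\<lambda>x. x \<in> A)"
    proof (rule finitaryI)
      fix x assume x: "x \<in> Free d"
      obtain k where k: "x \<in> U k" using cover[OF x] by blast
      obtain F where F: "finite F" "F \<subseteq> lattice_Z d"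
        "\<And>y. y \<in> Free d \<Longrightarrow> (\<And>u. u \<in> F \<Longrightarrow> y u = x u) \<Longrightarrow>
          (y \<in> U k, y \<in> greedy U N (Suc k)) = (x \<in> U k, x \<in> greedy U N (Suc k))"
        using finitaryE[OF finitary_combine[OF finU finG, where h = Pair] x] by blast
      have "(y \<in> A) = (x \<in> A)" if "y \<in> Free d" "\<forall>u\<in>F. y u = x u" for y
        using F(3)[OF that(1)] that(2) stage k by (metis Pair_inject)
      then show "\<exists>F. finite F \<and> F \<subseteq> lattice_Z d \<and>
          (\<forall>y\<in>Free d. (\<forall>u\<in>F. y u = x u) \<longrightarrow> (y \<in> A) = (x \<in> A))"
        using F(1,2) by blast
    qed
    show "\<exists>g\<in>cube d L. shift d g x \<in> A" if x: "x \<in> Free d" for x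
    proof -
      obtain k where k: "x \<in> U k" using cover[OF x] by blast
      have "x = shift d 0 x" using x by (simp add: shift_zero Free_iff)
      then show ?thesis using dich[OF k] cube0 unfolding A_def by (metis UNIV_I UN_I)
    qed
  qed (fact sep)
qed

section \<open>The graphs of local nets\<close>

definition overlap :: "nat \<Rightarrow> int \<Rightarrow> (nat \<Rightarrow> int) \<Rightarrow> (nat \<Rightarrow> int) set \<Rightarrow> (nat \<Rightarrow> int) set \<Rightarrow> bool" where
  "overlap d L g D E \<longleftrightarrow> D \<inter> (+) g ` cube d (2 * L) = (+) g ` E \<inter> cube d (2 * L)"

lemma pverts_M_graph: "pverts (M_graph d L) = M_verts d L"
  and parcs_M_graph: "(D, E) \<in> parcs (M_graph d L) \<longleftrightarrow>
    D \<in> M_verts d L \<and> E \<in> M_verts d L \<and> (\<exists>g\<in>gens d. overlap d L g D E)"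
  by (simp_all add: M_graph_def Let_def overlap_def)

text \<open>An edge labelled \<open>g\<close> translates the net by \<open>- g\<close>; a point is
  lost only when it leaves the cube of radius \<open>2 * L\<close>.\<close>

lemma overlapD:
  assumes "overlap d L g D E" "u \<in> D" "u - g \<in> cube d (2 * L)"
    and D: "D \<subseteq> cube d (2 * L)"
  shows "u - g \<in> E"
proof -
  have "u \<in> D \<inter> (+) g ` cube d (2 * L)"
    using assms(2,3) by (auto simp: image_iff intro!: bexI[of _ "u - g"])
  then have "u \<in> (+) g ` E" using assms(1) by (auto simp: overlap_def)
  then show ?thesis by auto
qed

lemma overlap_sym:
  assumes "overlap d L g D E"
  shows "overlap d L (- g) E D"
proof -
  let ?Q = "cube d (2 * L)"
  have "(+) (- g) ` (D \<inter> (+) g ` ?Q) = (+) (- g) ` ((+) g ` E \<inter> ?Q)"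
    using assms by (simp add: overlap_def)
  moreover have "(+) (- g) ` (D \<inter> (+) g ` ?Q) = (+) (- g) ` D \<inter> ?Q"
    by (simp add: image_Int image_image)
  moreover have "(+) (- g) ` ((+) g ` E \<inter> ?Q) = E \<inter> (+) (- g) ` ?Q"
    by (simp add: image_Int image_image)
  ultimately show ?thesis by (auto simp: overlap_def)
qed

lemma gens_uminus: "g \<in> gens d \<Longrightarrow> - g \<in> gens d"
  by (auto simp: gens_def)

lemma gens_abs_le: "g \<in> gens d \<Longrightarrow> \<bar>g i\<bar> \<le> 1"
  by (auto simp: gens_def unit_vec_def)

lemma gens_lattice_Z: "g \<in> gens d \<Longrightarrow> g \<in> lattice_Z d"
  by (auto simp: gens_def lattice_Z_intros)

lemma gens_nonzero: "g \<in> gens d \<Longrightarrow> g \<noteq> 0"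
  by (auto simp: gens_def unit_vec_def fun_eq_iff)

lemma M_vertsD:
  assumes "D \<in> M_verts d L" "d \<ge> 1"
  shows "D \<subseteq> cube d (2 * L)"
    and "\<And>p q. p \<in> D \<Longrightarrow> q \<in> D \<Longrightarrow> (\<And>i. i < d \<Longrightarrow> \<bar>p i - q i\<bar> \<le> L) \<Longrightarrow> p = q"
    and "\<And>u. u \<in> cube d L \<Longrightarrow> \<exists>p\<in>D. \<forall>i<d. \<bar>u i - p i\<bar> \<le> L"
proof -
  have gt: "L < sup_dist d u v \<longleftrightarrow> \<not> (\<forall>i<d. \<bar>u i - v i\<bar> \<le> L)" for u v
    using sup_dist_le_iff[OF assms(2), of u v L] by (simp add: not_le[symmetric] del: not_le)
  have D: "D \<subseteq> cube d (2 * L)"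
    "\<forall>p\<in>D. \<forall>q\<in>D. p \<noteq> q \<longrightarrow> \<not> (\<forall>i<d. \<bar>p i - q i\<bar> \<le> L)"
    "\<forall>u\<in>cube d L. \<exists>p\<in>D. \<forall>i<d. \<bar>u i - p i\<bar> \<le> L"
    using assms(1) unfolding M_verts_def gt sup_dist_le_iff[OF assms(2)] by simp_all
  show "D \<subseteq> cube d (2 * L)" by (rule D(1))
  show "p = q" if "p \<in> D" "q \<in> D" "\<And>i. i < d \<Longrightarrow> \<bar>p i - q i\<bar> \<le> L" for p q
    using D(2) that by blast
  show "\<exists>p\<in>D. \<forall>i<d. \<bar>u i - p i\<bar> \<le> L" if "u \<in> cube d L" for u
    using D(3) that by blast
qed

text \<open>This is the covering condition at the origin. Such a point survives \<open>L\<close>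
  unit moves before it can leave the large cube.\<close>

lemma M_verts_central:
  assumes "D \<in> M_verts d L" "d \<ge> 1" "L \<ge> 0"
  obtains p where "p \<in> D" "p \<in> cube d L"
proof -
  have "0 \<in> cube d L" using assms(3) by (intro cubeI) (auto simp: lattice_Z_zero)
  then obtain p where p: "p \<in> D" "\<forall>i<d. \<bar>0 i - p i\<bar> \<le> L"
    using M_vertsD(3)[OF assms(1,2)] by blast
  moreover have "p \<in> lattice_Z d"
    using p(1) M_vertsD(1)[OF assms(1,2)] cube_subset_lattice_Z by blast
  ultimately show ?thesis by (intro that cubeI) auto
qed

lemma cube_diff_gens:
  assumes "u \<in> cube d r" "g \<in> gens d" "r + 1 \<le> s"
  shows "u - g \<in> cube d s"
proof (rule cubeI)
  show "u - g \<in> lattice_Z d"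
    using assms by (intro lattice_Z_diff gens_lattice_Z[OF assms(2)] subsetD[OF cube_subset_lattice_Z assms(1)])
  fix i assume "i < d"
  then show "\<bar>(u - g) i\<bar> \<le> s"
    using cube_abs_le[OF assms(1), of i] gens_abs_le[OF assms(2), of i] assms(3) by auto
qed

lemma pair_graph_M_graph:
  assumes d: "d \<ge> 1" and L: "L \<ge> 1"
  shows "pair_graph (M_graph d L)"
proof
  have "M_verts d L \<subseteq> Pow (cube d (2 * L))" by (auto simp: M_verts_def)
  then show fin: "finite (pverts (M_graph d L))"
    unfolding pverts_M_graph by (rule finite_subset) simp
  show wf: "fst e \<in> pverts (M_graph d L)" "snd e \<in> pverts (M_graph d L)"
    if "e \<in> parcs (M_graph d L)" for e
    using that by (cases e, simp add: pverts_M_graph parcs_M_graph)+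
  have "parcs (M_graph d L) \<subseteq> pverts (M_graph d L) \<times> pverts (M_graph d L)"
    using wf by (auto simp: mem_Times_iff)
  then show "finite (parcs (M_graph d L))"
    by (rule finite_subset) (use fin in simp)
  show "symmetric (M_graph d L)"
    unfolding symmetric_def by (auto intro!: symI simp: parcs_M_graph) (metis gens_uminus overlap_sym)+
  show "fst e \<noteq> snd e" if "e \<in> parcs (M_graph d L)" for e
  proof
    assume "fst e = snd e"
    then obtain D where "(D, D) \<in> parcs (M_graph d L)" using \<open>e \<in> _\<close> by (cases e) simp
    then obtain g where D: "D \<in> M_verts d L" and g: "g \<in> gens d" "overlap d L g D D"
      unfolding parcs_M_graph by blast
    \<comment> \<open>A loop would put both \<open>p\<close> and \<open>p - g\<close>, at distance
      1, into the same net.\<close>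
    obtain p where p: "p \<in> D" "p \<in> cube d L" using M_verts_central[OF D d] L by auto
    have "p - g \<in> D"
      using overlapD[OF g(2) p(1) cube_diff_gens[OF p(2) g(1)] M_vertsD(1)[OF D d]] L by auto
    moreover have "\<bar>p i - (p - g) i\<bar> \<le> L" for i using gens_abs_le[OF g(1), of i] L by simp
    ultimately have "p = p - g" using M_vertsD(2)[OF D d p(1)] by blast
    then have "g = p - p" by (metis diff_diff_eq2 add_diff_cancel_left')
    then show False using gens_nonzero[OF g(1)] by simp
  qed
qed

theorem M_graph_in_HH:
  assumes d: "d \<ge> 1" and L: "L \<ge> 1"
  shows "M_graph d L \<in> HH d"
proof -
  obtain A where A: "A \<subseteq> Free d" "finitary d (\<lambda>x. x \<in> A)"
    and sep: "\<And>x g. x \<in> A \<Longrightarrow> shift d g x \<in> A \<Longrightarrow> g \<in> cube d L \<Longrightarrow> g = 0"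
    and max: "\<And>x. x \<in> Free d \<Longrightarrow> \<exists>g\<in>cube d L. shift d g x \<in> A"
    using ex_maximal_discrete[of L d] L by auto
  define c where "c = (\<lambda>x. {u \<in> cube d (2 * L). shift d u x \<in> A})"
  have lat: "u \<in> lattice_Z d" if "u \<in> cube d r" for u r
    using that cube_subset_lattice_Z by auto
  have c_vert: "c x \<in> M_verts d L" if x: "x \<in> Free d" for x
    unfolding M_verts_def
  proof (intro CollectI conjI ballI impI)
    fix p q assume pq: "p \<in> c x" "q \<in> c x" "p \<noteq> q"
    show "sup_dist d p q > L"
    proof (rule ccontr)
      assume "\<not> sup_dist d p q > L"
      then have *: "\<bar>p i - q i\<bar> \<le> L" if "i < d" for i
        using that d by (simp add: not_less sup_dist_le_iff)
      have pqQ: "p \<in> cube d (2 * L)" "q \<in> cube d (2 * L)" using pq by (auto simp: c_def)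
      have "p - q \<in> cube d L"
        using * by (intro cubeI lattice_Z_diff lat[OF pqQ(1)] lat[OF pqQ(2)]) auto
      moreover have "shift d (p - q) (shift d q x) = shift d p x"
        using pqQ by (subst shift_shift) (simp_all add: lattice_Z_diff lat)
      ultimately have "p - q = 0" using pq by (intro sep[of "shift d q x"]) (auto simp: c_def)
      then show False using pq by simp
    qed
  next
    fix u assume u: "u \<in> cube d L"
    obtain g where g: "g \<in> cube d L" "shift d g (shift d u x) \<in> A"
      using max[OF shift_Free[OF x lat[OF u]]] by blast
    \<comment> \<open>Here the radius \<open>2 * L\<close> enters: the covered point and the way to
      its net point contribute \<open>L\<close> each.\<close>
    have "g + u \<in> cube d (2 * L)"
    proof (rule cubeI)
      fix i assume "i < d"
      then show "\<bar>(g + u) i\<bar> \<le> 2 * L"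
        using cube_abs_le[OF u, of i] cube_abs_le[OF g(1), of i] by simp
    qed (intro lattice_Z_add lat[OF u] lat[OF g(1)])
    then have "g + u \<in> c x" using g by (simp add: c_def shift_shift lat)
    moreover have "sup_dist d u (g + u) \<le> L"
      using cube_abs_le[OF g(1)] d by (simp add: sup_dist_le_iff)
    ultimately show "\<exists>p\<in>c x. sup_dist d u p \<le> L" by blast
  qed (auto simp: c_def)
  have adj: "(c x, c (shift d (unit_vec i) x)) \<in> parcs (M_graph d L)" if x: "x \<in> Free d" and i: "i < d" for x i
  proof -
    have "overlap d L (unit_vec i) (c x) (c (shift d (unit_vec i) x))"
      unfolding overlap_def
      using i by (auto simp: c_def shift_shift lat lattice_Z_intros add.commute)
    moreover have "unit_vec i \<in> gens d" using i by (auto simp: gens_def)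
    ultimately show ?thesis
      unfolding parcs_M_graph using x i by (auto intro!: c_vert shift_Free lattice_Z_intros)
  qed
  have "finitary d c"
    unfolding c_def by (intro finitary_Collect finitary_shift A lat) auto
  then show ?thesis
    unfolding HH_iff_finitary using pair_graph_M_graph[OF d L] c_vert adj
    by (intro conjI exI[of _ c]) (auto simp: pverts_M_graph)
qed

section \<open>Toeplitz configurations\<close>

text \<open>This is the period-doubling sequence. At 0 the multiplicity is 0 by convention, so the
  value there is False.\<close>

definition toeplitz :: "int \<Rightarrow> bool" where
  "toeplitz a = odd (multiplicity 2 a)"

text \<open>The length \<open>S\<close> depends on \<open>g\<close> only. Both outcomes
  \<open>b\<close> are provided so that the contribution of other coordinates can be matched
  later.\<close>

lemma toeplitz_flip:
  assumes "g \<noteq> 0"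
  obtains S where "S > 0" "\<And>a b. \<exists>t. 0 \<le> t \<and> t < S \<and> (toeplitz (a + t + g) \<noteq> toeplitz (a + t)) = b"
proof -
  define m where "m = multiplicity 2 g"
  have g: "(2::int) ^ m dvd g" "\<not> 2 ^ Suc m dvd g"
    using assms unfolding m_def by (auto simp: power_dvd_iff_le_multiplicity simp del: power_Suc)
  have exact: "\<not> 2 ^ Suc j dvd 2 ^ j * c" if "odd c" for j and c :: int
    using that by (simp add: power_Suc2 del: power_Suc)
  have val: "multiplicity 2 x = m" if x: "2 ^ Suc m dvd x - g \<or> 2 ^ Suc m dvd x + g" for x
  proof (rule multiplicity_eqI)
    have "(2::int) ^ m dvd 2 ^ Suc m" by simp
    then have "2 ^ m dvd x - g \<or> 2 ^ m dvd x + g" using x dvd_trans by blast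
    then show "2 ^ m dvd x" using g(1) by (metis dvd_add dvd_diff diff_add_cancel add_diff_cancel)
    show "\<not> 2 ^ Suc m dvd x"
      using x g(2) dvd_diff[of "2 ^ Suc m" x "x - g"] dvd_diff[of "2 ^ Suc m" "x + g" x] by auto
  qed
  show ?thesis
  proof (rule that)
    fix a :: int and b
    \<comment> \<open>For \<open>b\<close> true, \<open>a + t\<close> and \<open>a + t + g\<close>
      get the valuations \<open>m\<close> and \<open>m + 1\<close>; otherwise \<open>m + 2\<close>
      and \<open>m\<close>. All of these are determined modulo \<open>2 ^ (m + 3)\<close>.\<close>
    define w where "w = (if b then 2 ^ Suc m - g else 2 ^ Suc (Suc m))"
    define t where "t = (w - a) mod 2 ^ (m + 3)"
    have t: "0 \<le> t" "t < 2 ^ (m + 3)" by (auto simp: t_def)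
    have "a + t = w + 2 ^ (m + 3) * (- ((w - a) div 2 ^ (m + 3)))"
      unfolding t_def by (simp add: minus_div_mult_eq_mod[symmetric] algebra_simps)
    then obtain k where k: "a + t = w + 2 ^ (m + 3) * k" by blast
    have "(toeplitz (a + t + g) \<noteq> toeplitz (a + t)) = b"
    proof (cases b)
      case True
      have eq: "a + t + g = 2 ^ Suc m * (1 + 4 * k)"
        using k True by (simp add: w_def power_add algebra_simps)
      have "multiplicity 2 (a + t + g) = Suc m"
      proof (rule multiplicity_eqI)
        show "2 ^ Suc m dvd a + t + g" unfolding eq by (rule dvd_triv_left)
        show "\<not> 2 ^ Suc (Suc m) dvd a + t + g" unfolding eq by (rule exact) simp
      qed
      moreover have "multiplicity 2 (a + t) = m"
        using eq by (intro val disjI2) simp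
      ultimately show ?thesis using True by (simp add: toeplitz_def)
    next
      case False
      have eq: "a + t = 2 ^ Suc (Suc m) * (1 + 2 * k)"
        using k False by (simp add: w_def power_add algebra_simps)
      have "multiplicity 2 (a + t) = Suc (Suc m)"
      proof (rule multiplicity_eqI)
        show "2 ^ Suc (Suc m) dvd a + t" unfolding eq by (rule dvd_triv_left)
        show "\<not> 2 ^ Suc (Suc (Suc m)) dvd a + t" unfolding eq by (rule exact) simp
      qed
      moreover have "multiplicity 2 (a + t + g) = m"
        using eq by (intro val disjI1) simp
      ultimately show ?thesis using False by (simp add: toeplitz_def)
    qed
    then show "\<exists>t. 0 \<le> t \<and> t < 2 ^ (m + 3) \<and> (toeplitz (a + t + g) \<noteq> toeplitz (a + t)) = b"
      using t by blast
  qed simp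
qed

section \<open>Embedding the free part in dimension \<open>d\<close> into that in dimension
  \<open>d + 1\<close>\<close>

definition prod_toeplitz :: "nat \<Rightarrow> ((nat \<Rightarrow> int) \<Rightarrow> bool) \<Rightarrow> (nat \<Rightarrow> int) \<Rightarrow> bool" where
  "prod_toeplitz d x = (\<lambda>u\<in>lattice_Z (Suc d). x (u(d := 0)) \<noteq> toeplitz (u d))"

lemma lattice_Z_Suc_proj: "u \<in> lattice_Z (Suc d) \<Longrightarrow> u(d := 0) \<in> lattice_Z d"
  by (auto simp: lattice_Z_def)

lemma lattice_Z_Suc_mono: "u \<in> lattice_Z d \<Longrightarrow> u \<in> lattice_Z (Suc d)"
  by (auto simp: lattice_Z_def)

text \<open>A translation with \<open>g d = 0\<close> is detected by \<open>x\<close> in a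
  hyperplane. Otherwise one looks along the last axis, where the contribution of \<open>x\<close>
  does not depend on \<open>t\<close> and the Toeplitz factor can be made to flip or not, as
  required.\<close>

lemma prod_toeplitz_Free:
  assumes x: "x \<in> Free d"
  shows "prod_toeplitz d x \<in> Free (Suc d)"
  unfolding Free_iff
proof (intro conjI ballI impI)
  fix g assume g: "g \<in> lattice_Z (Suc d)" "g \<noteq> 0"
  show "\<exists>u\<in>lattice_Z (Suc d). prod_toeplitz d x (u + g) \<noteq> prod_toeplitz d x u"
  proof (cases "g d = 0")
    case True
    then have gd: "g \<in> lattice_Z d" using lattice_Z_Suc_proj[OF g(1)] by (metis fun_upd_triv)
    then obtain u where u: "u \<in> lattice_Z d" "x (u + g) \<noteq> x u"
      using x g unfolding Free_iff by blast
    have "u d = 0" using u by (simp add: lattice_Z_def)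
    moreover have "(u + g)(d := 0) = u + g" "u(d := 0) = u"
      using \<open>u d = 0\<close> True by (auto simp: fun_eq_iff)
    ultimately show ?thesis
      using u g True by (intro bexI[of _ u])
        (auto simp: prod_toeplitz_def lattice_Z_Suc_mono lattice_Z_add)
  next
    case False
    define b where "b \<longleftrightarrow> x (g(d := 0)) = x 0"
    obtain S where "\<And>a b. \<exists>t. 0 \<le> t \<and> t < S \<and> (toeplitz (a + t + g d) \<noteq> toeplitz (a + t)) = b"
      using toeplitz_flip[OF False] by metis
    from this[of 0 b] obtain t where t: "(toeplitz (t + g d) \<noteq> toeplitz t) = b" by auto
    define u where "u = (0 :: nat \<Rightarrow> int)(d := t)"
    have u: "u \<in> lattice_Z (Suc d)" "(u + g)(d := 0) = g(d := 0)" "u(d := 0) = 0" "u d = t"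
      by (auto simp: u_def lattice_Z_def fun_eq_iff)
    then show ?thesis
      using t g by (intro bexI[of _ u]) (auto simp: prod_toeplitz_def lattice_Z_add b_def)
  qed
qed (simp add: prod_toeplitz_def)

text \<open>Colourings are pulled back along \<open>prod_toeplitz\<close>, which is continuous and
  equivariant for the first \<open>d\<close> generators.\<close>

lemma HH_Suc_subset: "HH (Suc d) \<subseteq> HH d"
proof
  fix H :: "'a pair_pre_digraph" assume "H \<in> HH (Suc d)"
  then obtain c where H: "pair_graph H" and c: "c \<in> Free (Suc d) \<rightarrow> pverts H" "finitary (Suc d) c"
    "\<forall>x\<in>Free (Suc d). \<forall>i<Suc d. (c x, c (shift (Suc d) (unit_vec i) x)) \<in> parcs H"
    unfolding HH_iff_finitary by blast
  have eqv: "prod_toeplitz d (shift d (unit_vec i) x) = shift (Suc d) (unit_vec i) (prod_toeplitz d x)"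
    if i: "i < d" for i x
  proof
    fix u
    have "(u + unit_vec i)(d := 0) = u(d := 0) + unit_vec i" "(u + unit_vec i) d = u d"
      using i by (auto simp: fun_eq_iff unit_vec_def)
    then show "prod_toeplitz d (shift d (unit_vec i) x) u = shift (Suc d) (unit_vec i) (prod_toeplitz d x) u"
      using i by (simp add: prod_toeplitz_def shift_def lattice_Z_Suc_proj lattice_Z_add lattice_Z_unit_vec)
  qed
  have "finitary d (\<lambda>x. c (prod_toeplitz d x))"
  proof (rule finitaryI)
    fix x assume x: "x \<in> Free d"
    obtain F where F: "finite F" "F \<subseteq> lattice_Z (Suc d)"
      "\<And>y. y \<in> Free (Suc d) \<Longrightarrow> (\<And>u. u \<in> F \<Longrightarrow> y u = prod_toeplitz d x u) \<Longrightarrow> c y = c (prod_toeplitz d x)"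
      using finitaryE[OF c(2) prod_toeplitz_Free[OF x]] by blast
    have "c (prod_toeplitz d y) = c (prod_toeplitz d x)"
      if y: "y \<in> Free d" "\<forall>u\<in>(\<lambda>u. u(d := 0)) ` F. y u = x u" for y
      using F(2) y by (intro F(3) prod_toeplitz_Free) (auto simp: prod_toeplitz_def)
    then show "\<exists>F. finite F \<and> F \<subseteq> lattice_Z d \<and>
        (\<forall>y\<in>Free d. (\<forall>u\<in>F. y u = x u) \<longrightarrow> c (prod_toeplitz d y) = c (prod_toeplitz d x))"
      using F(1,2) by (intro exI[of _ "(\<lambda>u. u(d := 0)) ` F"]) (auto simp: lattice_Z_Suc_proj)
  qed
  then show "H \<in> HH d"
    unfolding HH_iff_finitary using H c eqv
    by (intro conjI exI[of _ "\<lambda>x. c (prod_toeplitz d x)"]) (auto simp: prod_toeplitz_Free)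
qed

section \<open>Uniform continuity on uniformly aperiodic configurations\<close>

text \<open>\<open>s g\<close> is a search radius within which, from every position, the period
  \<open>g\<close> is seen to fail. Fixing \<open>s\<close> turns freeness into a closed
  condition.\<close>

definition aperiodic_within :: "nat \<Rightarrow> ((nat \<Rightarrow> int) \<Rightarrow> int) \<Rightarrow> ((nat \<Rightarrow> int) \<Rightarrow> bool) \<Rightarrow> bool" where
  "aperiodic_within n s x \<longleftrightarrow> x \<in> extensional (lattice_Z n) \<and>
    (\<forall>g\<in>lattice_Z n. g \<noteq> 0 \<longrightarrow> (\<forall>v\<in>lattice_Z n. \<exists>t\<in>cube n (s g). x (v + t + g) \<noteq> x (v + t)))"

lemma aperiodic_within_Free:
  assumes "aperiodic_within n s x"
  shows "x \<in> Free n"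
proof -
  have "\<exists>u\<in>lattice_Z n. x (u + g) \<noteq> x u" if g: "g \<in> lattice_Z n" "g \<noteq> 0" for g
  proof -
    obtain t where "t \<in> cube n (s g)" "x (0 + t + g) \<noteq> x (0 + t)"
      using assms g lattice_Z_zero unfolding aperiodic_within_def by blast
    then show ?thesis using cube_subset_lattice_Z by (intro bexI[of _ t]) auto
  qed
  then show ?thesis using assms unfolding Free_iff aperiodic_within_def by blast
qed

lemma aperiodic_within_shift:
  assumes x: "aperiodic_within n s x" and u: "u \<in> lattice_Z n"
  shows "aperiodic_within n s (shift n u x)"
  unfolding aperiodic_within_def
proof (intro conjI ballI impI)
  fix g v assume g: "g \<in> lattice_Z n" "g \<noteq> 0" and v: "v \<in> lattice_Z n"
  obtain t where t: "t \<in> cube n (s g)" "x (v + u + t + g) \<noteq> x (v + u + t)"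
    using x g lattice_Z_add[OF v u] unfolding aperiodic_within_def by blast
  then have "t \<in> lattice_Z n" using cube_subset_lattice_Z by blast
  then show "\<exists>t\<in>cube n (s g). shift n u x (v + t + g) \<noteq> shift n u x (v + t)"
    using t u v g by (intro bexI[of _ t]) (simp_all add: shift_apply lattice_Z_add ac_simps)
qed (rule shift_extensional)

text \<open>The configurations with a given \<open>s\<close> form a compact set \<open>K\<close>.
  Finitely many of the cylinders on which \<open>c\<close> is constant cover \<open>K\<close>, and a
  cube containing their windows serves all of \<open>K\<close>.\<close>

lemma uniform_window:
  assumes c: "finitary n c"
  obtains r where "r \<ge> 0" "\<forall>x y. aperiodic_within n s x \<longrightarrow> y \<in> Free n \<longrightarrow>
    (\<forall>u\<in>cube n r. y u = x u) \<longrightarrow> c y = c x"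
proof -
  define K where "K = {x. aperiodic_within n s x}"
  let ?X = "extensional (lattice_Z n) :: ((nat \<Rightarrow> int) \<Rightarrow> bool) set"
  have lat: "t \<in> lattice_Z n" if "t \<in> cube n r" for t r
    using that cube_subset_lattice_Z by blast
  have top: "subtopology (Cantor_Z n) ?X = Cantor_Z n"
    by (metis subtopology_topspace topspace_Cantor_Z)
  have KF: "K \<subseteq> Free n" using aperiodic_within_Free by (auto simp: K_def)
  have KX: "K \<subseteq> ?X" by (auto simp: K_def aperiodic_within_def)
  have "openin (subtopology (Cantor_Z n) ?X) (?X - K)"
    unfolding openin_Cantor_Z_iff[OF order_refl]
  proof (intro conjI ballI)
    fix x assume x: "x \<in> ?X - K"
    then obtain g v where gv: "g \<in> lattice_Z n" "g \<noteq> 0" "v \<in> lattice_Z n"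
      "\<forall>t\<in>cube n (s g). x (v + t + g) = x (v + t)"
      unfolding K_def aperiodic_within_def by blast
    \<comment> \<open>A violation at \<open>g\<close> and \<open>v\<close> involves only the
      finitely many positions in \<open>F\<close>, so the complement of \<open>K\<close> is
      open.\<close>
    define F where "F = (\<lambda>t. v + t + g) ` cube n (s g) \<union> (\<lambda>t. v + t) ` cube n (s g)"
    have "y \<in> ?X - K" if y: "y \<in> ?X" "\<forall>u\<in>F. y u = x u" for y
    proof -
      have "y (v + t + g) = y (v + t)" if "t \<in> cube n (s g)" for t
        using y(2) gv(4) that unfolding F_def by auto
      then show ?thesis using gv y(1) unfolding K_def aperiodic_within_def by blast
    qed
    moreover have "finite F" "F \<subseteq> lattice_Z n"
      unfolding F_def using gv by (auto intro!: lattice_Z_add dest: lat)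
    ultimately show "\<exists>F. finite F \<and> F \<subseteq> lattice_Z n \<and>
        (\<forall>y\<in>?X. (\<forall>u\<in>F. y u = x u) \<longrightarrow> y \<in> ?X - K)"
      by blast
  qed blast
  then have "closedin (Cantor_Z n) K"
    unfolding top closedin_def topspace_Cantor_Z using KX by simp
  moreover have "compact_space (Cantor_Z n)"
    unfolding Cantor_Z_def by (simp add: compact_space_product_topology compact_space_discrete_topology)
  ultimately have compact: "compactin (Cantor_Z n) K"
    by (rule closedin_compact_space[rotated])
  have "\<forall>x\<in>K. \<exists>F. finite F \<and> F \<subseteq> lattice_Z n \<and> (\<forall>y\<in>Free n. (\<forall>u\<in>F. y u = x u) \<longrightarrow> c y = c x)"
    using c KF unfolding finitary_def by blast
  then obtain W where W: "\<And>x. x \<in> K \<Longrightarrow> finite (W x)" "\<And>x. x \<in> K \<Longrightarrow> W x \<subseteq> lattice_Z n"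
    "\<And>x y. x \<in> K \<Longrightarrow> y \<in> Free n \<Longrightarrow> \<forall>u\<in>W x. y u = x u \<Longrightarrow> c y = c x"
    by metis
  define U where "U = (\<lambda>x. {y \<in> ?X. \<forall>u\<in>W x. y u = x u})"
  have "openin (Cantor_Z n) (U x)" if x: "x \<in> K" for x
  proof -
    have "openin (subtopology (Cantor_Z n) ?X) (U x)"
      unfolding openin_Cantor_Z_iff[OF order_refl]
      by (intro conjI ballI exI[of _ "W x"]) (use W[OF x] in \<open>auto simp: U_def\<close>)
    then show ?thesis unfolding top .
  qed
  then have "openin (Cantor_Z n) V" if "V \<in> U ` K" for V using that by blast
  moreover have "K \<subseteq> \<Union>(U ` K)" using KX unfolding U_def by blast
  ultimately obtain \<F> where \<F>: "finite \<F>" "\<F> \<subseteq> U ` K" "K \<subseteq> \<Union>\<F>"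
    using compactinD[OF compact, of "U ` K"] by blast
  then obtain X where X: "X \<subseteq> K" "finite X" "\<F> = U ` X"
    by (meson finite_subset_image)
  have "finite (\<Union>x\<in>X. W x)" "(\<Union>x\<in>X. W x) \<subseteq> lattice_Z n" using X W by auto
  then obtain r where r: "r \<ge> 0" "(\<Union>x\<in>X. W x) \<subseteq> cube n r" by (rule finite_subset_cube)
  show ?thesis
  proof (rule that[OF r(1)], intro allI impI)
    fix x y assume "aperiodic_within n s x" and y: "y \<in> Free n" "\<forall>u\<in>cube n r. y u = x u"
    then have xK: "x \<in> K" by (simp add: K_def)
    then obtain a where a: "a \<in> X" "x \<in> U a" using \<F>(3) X(3) by blast
    have "c x = c a"
      using a X KF xK by (intro W(3)) (auto simp: U_def)
    moreover have "c y = c a"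
    proof (intro W(3) y(1) ballI)
      show "y u = a u" if "u \<in> W a" for u
        using that a r(2) y(2) by (auto simp: U_def)
    qed (use a X in auto)
    ultimately show "c y = c x" by simp
  qed
qed

section \<open>Tilings with two coprime periods\<close>

definition along :: "nat \<Rightarrow> int \<Rightarrow> nat \<Rightarrow> int" where
  "along i a = (\<lambda>j. if j = i then a else 0)"

lemma along_simps: "along i a j = (if j = i then a else 0)"
  by (simp add: along_def)

lemma along_lattice_Z: "i < n \<Longrightarrow> along i a \<in> lattice_Z n"
  by (simp add: along_def lattice_Z_def)

text \<open>This is the exclusive or of the sequences \<open>toeplitz (u i)\<close>.\<close>

definition toeplitz_sum :: "nat \<Rightarrow> (nat \<Rightarrow> int) \<Rightarrow> bool" where
  "toeplitz_sum n u \<longleftrightarrow> odd (\<Sum>i<n. multiplicity 2 (u i))"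

lemma toeplitz_sum_cong:
  assumes "\<And>i. i < n \<Longrightarrow> multiplicity 2 (u i) = multiplicity 2 (v i)"
  shows "toeplitz_sum n u = toeplitz_sum n v"
  using assms by (simp add: toeplitz_sum_def)

text \<open>Only a coordinate \<open>i\<close> with \<open>g i\<close> nonzero is varied. The others
  contribute a constant \<open>R\<close>, and \<open>toeplitz_flip\<close> is applied with the
  outcome that this constant requires.\<close>

lemma toeplitz_sum_flip:
  assumes g: "g \<in> lattice_Z n" "g \<noteq> 0"
  obtains i S where "i < n" "S > 0"
    "\<And>v. \<exists>t. 0 \<le> t \<and> t < S \<and> toeplitz_sum n (v + along i t + g) \<noteq> toeplitz_sum n (v + along i t)"
proof -
  have "\<exists>i<n. g i \<noteq> 0"
  proof (rule ccontr)
    assume "\<not> (\<exists>i<n. g i \<noteq> 0)"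
    then have "g i = 0" for i using g(1) by (cases "i < n") (auto simp: lattice_Z_def)
    then show False using g(2) by (auto simp: fun_eq_iff)
  qed
  then obtain i where i: "i < n" "g i \<noteq> 0" by blast
  obtain S where S: "S > 0"
    "\<And>a b. \<exists>t. 0 \<le> t \<and> t < S \<and> (toeplitz (a + t + g i) \<noteq> toeplitz (a + t)) = b"
    using toeplitz_flip[OF i(2)] by metis
  define R where "R = (\<lambda>w. odd (\<Sum>j\<in>{..<n} - {i}. multiplicity 2 (w j :: int)))"
  have split: "toeplitz_sum n w \<longleftrightarrow> toeplitz (w i) \<noteq> R w" for w
    unfolding toeplitz_sum_def toeplitz_def R_def using i by (subst sum.remove[of _ i]) auto
  show ?thesis
  proof (rule that[OF i(1) S(1)])
    fix v
    have R: "R (w + along i t) = R w" for w t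
      unfolding R_def by (intro arg_cong[where f = odd] sum.cong) (auto simp: along_def)
    obtain t where t: "0 \<le> t" "t < S"
      "(toeplitz (v i + t + g i) \<noteq> toeplitz (v i + t)) = (R (v + g) = R v)"
      using S(2) by blast
    have "R (v + along i t + g) = R (v + g)"
      using R[of "v + g" t] by (simp add: ac_simps)
    then have "toeplitz_sum n (v + along i t + g) \<noteq> toeplitz_sum n (v + along i t)"
      using t(3) R[of v t] unfolding split by (auto simp: along_simps)
    then show "\<exists>t. 0 \<le> t \<and> t < S \<and> toeplitz_sum n (v + along i t + g) \<noteq> toeplitz_sum n (v + along i t)"
      using t by blast
  qed
qed

text \<open>Inside the box the tile is a piece of the Toeplitz pattern, repeated with period
  \<open>p\<close> on a quadrant of the first two coordinates and with period \<open>q\<close>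
  elsewhere. For every direction \<open>i\<close>, one of the directions 0 and 1 differs from
  \<open>i\<close> and leads out of the quadrant.\<close>

definition tiled :: "nat \<Rightarrow> int \<Rightarrow> int \<Rightarrow> int \<Rightarrow> (nat \<Rightarrow> int) \<Rightarrow> bool" where
  "tiled n p q T u \<longleftrightarrow> toeplitz_sum n
     (if \<forall>i<n. -T \<le> u i \<and> u i < T then \<lambda>i. u i mod (if u 0 < 0 \<and> u 1 < 0 then p else q) else u)"

text \<open>Where the quotients by \<open>p\<close> and \<open>q\<close> are constant, reduction
  modulo either subtracts a constant. As \<open>p\<close> divides \<open>T\<close>, the quotient by
  \<open>p\<close> also decides the sign of a coordinate and its position relative to the
  box.\<close>

lemma tiled_cell:
  assumes n: "n \<ge> 2" and pq: "p > 0" "q > 0" "p dvd T" "q dvd T"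
  obtains \<tau> where "\<And>u. (\<And>i. i < n \<Longrightarrow> u i div p = w i div p \<and> u i div q = w i div q) \<Longrightarrow>
      tiled n p q T u = toeplitz_sum n (u - \<tau>)"
proof -
  obtain T' where T: "T = p * T'" using pq by (auto elim: dvdE)
  have neg: "x < 0 \<longleftrightarrow> x div p < 0" for x :: int
    using pq(1) by (simp add: pos_imp_zdiv_neg_iff)
  have sub: "(x - p * K) div p = x div p - K" for x K :: int
    using div_mult_self2[of p x "- K"] pq(1) by simp
  have lt: "x < T \<longleftrightarrow> x div p < T'" for x :: int
    using neg[of "x - T"] sub[of x T'] unfolding T by auto
  have ge: "- T \<le> x \<longleftrightarrow> - T' \<le> x div p" for x :: int
    using neg[of "x + T"] sub[of x "- T'"] unfolding T by auto
  define \<tau> where "\<tau> = (\<lambda>i. if \<forall>i<n. -T \<le> w i \<and> w i < T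
    then let m = if w 0 < 0 \<and> w 1 < 0 then p else q in m * (w i div m) else 0)"
  show ?thesis
  proof (rule that[of \<tau>])
    fix u :: "nat \<Rightarrow> int"
    assume u: "\<And>i. i < n \<Longrightarrow> u i div p = w i div p \<and> u i div q = w i div q"
    have box: "(\<forall>i<n. -T \<le> u i \<and> u i < T) \<longleftrightarrow> (\<forall>i<n. -T \<le> w i \<and> w i < T)"
      unfolding lt ge using u by auto
    have "u 0 < 0 \<longleftrightarrow> w 0 < 0" "u 1 < 0 \<longleftrightarrow> w 1 < 0"
      using u[of 0] u[of 1] n neg[of "u 0"] neg[of "w 0"] neg[of "u 1"] neg[of "w 1"] by auto
    then show "tiled n p q T u = toeplitz_sum n (u - \<tau>)"
      unfolding tiled_def box using u
      by (auto intro!: toeplitz_sum_cong simp: \<tau>_def minus_mult_div_eq_mod[symmetric])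
  qed
qed

text \<open>An interval of length \<open>3 * l\<close> contains at most one multiple of
  \<open>p\<close> and one of \<open>q\<close>. Each spoils at most one of the three pieces of
  length \<open>l\<close>.\<close>

lemma multiple_free_interval:
  fixes a l p q :: int
  assumes l: "l > 0" and pq: "3 * l \<le> p" "3 * l \<le> q"
  obtains b where "a \<le> b" "b \<le> a + 2 * l"
    "\<And>x. b \<le> x \<Longrightarrow> x < b + l \<Longrightarrow> x div p = b div p \<and> x div q = b div q"
proof -
  \<comment> \<open>The index of the piece containing the least multiple of \<open>m\<close> that is
    at least \<open>a\<close>; above 2 it lies beyond the three pieces.\<close>
  define e where "e = (\<lambda>m. ((- a) mod m) div l)"
  have const: "x div m = (a + l * c) div m"
    if m: "3 * l \<le> m" and c: "c \<in> {0, 1, 2}" "c \<noteq> e m" and x: "a + l * c \<le> x" "x < a + l * c + l"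
    for m c x
  proof -
    define r where "r = (- a) mod m"
    define K where "K = (a + r) div m"
    have K: "m * K = a + r"
      unfolding K_def r_def by (subst dvd_mult_div_cancel) (auto simp: mod_eq_0_iff_dvd[symmetric] mod_simps)
    have r: "0 \<le> r" "r < m" using l m by (auto simp: r_def)
    have lc: "0 \<le> l * c" "l * c + l \<le> m" using c(1) l m by auto
    have "\<not> (l * c \<le> r \<and> r < l * c + l)"
    proof
      assume "l * c \<le> r \<and> r < l * c + l"
      then have "r div l = c"
        using l by (intro int_div_pos_eq[where r = "r - l * c"]) auto
      then show False using c(2) by (simp add: e_def r_def)
    qed
    then consider "r < l * c" | "l * c + l \<le> r" by linarith
    then show ?thesis
    proof cases
      case 1
      have "y div m = K" if "a + l * c \<le> y" "y < a + l * c + l" for y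
        using that 1 K r lc by (intro int_div_pos_eq[where r = "y - m * K"]; linarith)
      then show ?thesis using x l by auto
    next
      case 2
      have "m * (K - 1) = a + r - m" using K by (simp add: algebra_simps)
      then have "y div m = K - 1" if "a + l * c \<le> y" "y < a + l * c + l" for y
        using that 2 r lc by (intro int_div_pos_eq[where r = "y - m * (K - 1)"]; linarith)
      then show ?thesis using x l by auto
    qed
  qed
  have "\<exists>c\<in>{0, 1, 2::int}. c \<noteq> e p \<and> c \<noteq> e q" by (cases "e p = 0"; cases "e q = 0"; auto)
  then obtain c where c: "c \<in> {0, 1, 2}" "c \<noteq> e p" "c \<noteq> e q" by blast
  show ?thesis
  proof (rule that[of "a + l * c"])
    show "a \<le> a + l * c" "a + l * c \<le> a + 2 * l" using c(1) l by auto
    show "x div p = (a + l * c) div p \<and> x div q = (a + l * c) div q"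
      if "a + l * c \<le> x" "x < a + l * c + l" for x
      using const[OF pq(1) c(1,2) that] const[OF pq(2) c(1,3) that] by blast
  qed
qed

lemma tiled_outside:
  assumes "i < n" "u i < - T \<or> T \<le> u i"
  shows "tiled n p q T u = toeplitz_sum n u"
proof -
  have "\<not> (\<forall>j<n. - T \<le> u j \<and> u j < T)" using assms by (meson not_le)
  then show ?thesis by (simp only: tiled_def if_False)
qed

text \<open>The periods are consecutive, hence coprime, and \<open>tile_p k\<close> is odd with
  half-length \<open>2 * 2 ^ k\<close>, a power of 2. That power is what lets a tile repeat a
  pattern.\<close>

definition tile_p :: "nat \<Rightarrow> int" where "tile_p k = 4 * 2 ^ k + 1"
definition tile_q :: "nat \<Rightarrow> int" where "tile_q k = 4 * 2 ^ k"
definition tile_N :: "nat \<Rightarrow> int" where "tile_N k = tile_p k * tile_q k"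

definition tiling :: "nat \<Rightarrow> nat \<Rightarrow> (nat \<Rightarrow> int) \<Rightarrow> bool" where
  "tiling n k = restrict (tiled n (tile_p k) (tile_q k) (8 * tile_N k)) (lattice_Z n)"

lemma tiling_extensional: "tiling n k \<in> extensional (lattice_Z n)"
  by (simp add: tiling_def)

lemma tile_pos: "tile_p k > 0" "tile_q k > 0" "tile_N k > 0"
  by (auto simp: tile_p_def tile_q_def tile_N_def intro!: mult_pos_pos add_pos_pos)

lemma tile_N_mono: "k \<le> m \<Longrightarrow> tile_N k \<le> tile_N m"
  unfolding tile_N_def tile_p_def tile_q_def
  by (intro mult_mono add_mono power_increasing) auto

text \<open>The radius \<open>s\<close> must serve all \<open>k\<close> at once. For large tiles,
  every position is close to a cell in which the tiling is a translate of
  \<open>toeplitz_sum\<close>; for the finitely many small ones, it suffices to walk out of the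
  box.\<close>

lemma tiling_uniformly_aperiodic:
  assumes n: "n \<ge> 2" and g: "g \<in> lattice_Z n" "g \<noteq> 0"
  shows "\<exists>s. \<forall>k. \<forall>v\<in>lattice_Z n. \<exists>t\<in>cube n s. tiling n k (v + t + g) \<noteq> tiling n k (v + t)"
proof -
  obtain i S where i: "i < n" and S: "S > 0"
    "\<And>v. \<exists>t. 0 \<le> t \<and> t < S \<and> toeplitz_sum n (v + along i t + g) \<noteq> toeplitz_sum n (v + along i t)"
    using toeplitz_sum_flip[OF g] by metis
  define G where "G = (\<Sum>j<n. \<bar>g j\<bar>)"
  have G: "- G \<le> g j" "g j \<le> G" if "j < n" for j
    using member_le_sum[of j "{..<n}" "\<lambda>j. \<bar>g j\<bar>"] that unfolding G_def by auto
  have G0: "G \<ge> 0" unfolding G_def by (intro sum_nonneg) auto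
  \<comment> \<open>A cell of this length holds \<open>S\<close> trial positions with a margin
    \<open>G\<close> on both sides for the translate by \<open>g\<close>.\<close>
  define l where "l = 2 * G + S + 1"
  have l: "l > 0" using G0 S by (simp add: l_def)
  have near: "\<exists>t\<in>cube n (3 * l). tiling n k (v + t + g) \<noteq> tiling n k (v + t)"
    if v: "v \<in> lattice_Z n" and k: "3 * l \<le> tile_q k" for v k
  proof -
    have "3 * l \<le> tile_p k" using k by (simp add: tile_p_def tile_q_def)
    then have "\<exists>b. v j \<le> b \<and> b \<le> v j + 2 * l \<and> (\<forall>x. b \<le> x \<and> x < b + l \<longrightarrow>
        x div tile_p k = b div tile_p k \<and> x div tile_q k = b div tile_q k)" for j
      using multiple_free_interval[OF l _ k, of "tile_p k" "v j"] by metis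
    then obtain w where w: "\<And>j. v j \<le> w j" "\<And>j. w j \<le> v j + 2 * l"
      "\<And>j x. w j \<le> x \<Longrightarrow> x < w j + l \<Longrightarrow>
        x div tile_p k = w j div tile_p k \<and> x div tile_q k = w j div tile_q k"
      by metis
    have dvd: "tile_p k dvd 8 * tile_N k" "tile_q k dvd 8 * tile_N k"
      by (simp_all add: tile_N_def)
    obtain \<tau> where \<tau>: "\<And>u. (\<And>i. i < n \<Longrightarrow> u i div tile_p k = w i div tile_p k \<and> u i div tile_q k = w i div tile_q k) \<Longrightarrow>
      tiled n (tile_p k) (tile_q k) (8 * tile_N k) u = toeplitz_sum n (u - \<tau>)"
      using tiled_cell[OF n tile_pos(1,2) dvd, where w = w] by blast
    define w' where "w' = (\<lambda>j. if j < n then w j + G else 0)"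
    obtain t where t: "0 \<le> t" "t < S"
      "toeplitz_sum n (w' - \<tau> + along i t + g) \<noteq> toeplitz_sum n (w' - \<tau> + along i t)"
      using S(2)[of "w' - \<tau>"] by blast
    define u where "u = w' + along i t"
    have u: "w j + G \<le> u j" "u j < w j + G + S" if "j < n" for j
      using that t S(1) by (auto simp: u_def w'_def along_def)
    have uL: "u \<in> lattice_Z n" using i by (auto simp: u_def w'_def along_def lattice_Z_def)
    have "tiling n k (u + g) = toeplitz_sum n (u + g - \<tau>)"
      using uL g(1) u G by (auto simp: tiling_def lattice_Z_add l_def intro!: \<tau> w(3)) (smt (verit) u G)+
    moreover have "tiling n k u = toeplitz_sum n (u - \<tau>)"
      using uL u G0 by (auto simp: tiling_def l_def intro!: \<tau> w(3)) (smt (verit) u G0)+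
    moreover have "u + g - \<tau> = w' - \<tau> + along i t + g" "u - \<tau> = w' - \<tau> + along i t"
      by (simp_all add: u_def)
    ultimately have "tiling n k (u + g) \<noteq> tiling n k u" using t(3) by simp
    moreover have "u - v \<in> cube n (3 * l)"
    proof (intro cubeI lattice_Z_diff uL v)
      fix j assume "j < n"
      then show "\<bar>(u - v) j\<bar> \<le> 3 * l"
        using u[of j] w(1,2)[of j] G0 S(1) by (simp add: l_def)
    qed
    ultimately show ?thesis by (intro bexI[of _ "u - v"]) simp_all
  qed
  have far: "\<exists>t\<in>cube n (8 * tile_N k + G + 2 * S). tiling n k (v + t + g) \<noteq> tiling n k (v + t)"
    if v: "v \<in> lattice_Z n" for v k
  proof -
    let ?T = "8 * tile_N k"
    \<comment> \<open>Coordinate 0 is moved away from the origin, far enough that both compared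
      positions lie outside the box.\<close>
    define a where "a = (if v 0 \<ge> 0 then ?T + G else - (?T + G + S))"
    obtain t where t: "0 \<le> t" "t < S"
      "toeplitz_sum n (v + along 0 a + along i t + g) \<noteq> toeplitz_sum n (v + along 0 a + along i t)"
      using S(2)[of "v + along 0 a"] by blast
    define u where "u = along 0 a + along i t"
    have uL: "u \<in> lattice_Z n" unfolding u_def using i n by (intro lattice_Z_add along_lattice_Z) auto
    have u0: "u 0 = a + t \<or> u 0 = a" by (auto simp: u_def along_def)
    have out: "(v + u) 0 < - ?T \<or> ?T \<le> (v + u) 0" "(v + u + g) 0 < - ?T \<or> ?T \<le> (v + u + g) 0"
      using u0 t(1,2) G[of 0] n G0 unfolding a_def by (auto split: if_splits)
    have "tiling n k (v + u + g) = toeplitz_sum n (v + u + g)" "tiling n k (v + u) = toeplitz_sum n (v + u)"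
      using tiled_outside[of 0 n "v + u", OF _ out(1)] tiled_outside[of 0 n "v + u + g", OF _ out(2)] n uL v g(1)
      by (simp_all add: tiling_def lattice_Z_add)
    then have "tiling n k (v + u + g) \<noteq> tiling n k (v + u)"
      using t(3) by (simp add: u_def add.assoc)
    moreover have "u \<in> cube n (?T + G + 2 * S)"
      using uL t(1,2) G0 S(1) tile_pos(3)[of k]
      by (intro cubeI) (auto simp: u_def along_def a_def)
    ultimately show ?thesis by blast
  qed
  \<comment> \<open>Beyond this threshold the tiles are long enough for \<open>near\<close>.\<close>
  define k0 where "k0 = nat (3 * l)"
  have "int k0 < 2 ^ k0" using of_nat_less_two_power[of k0] by simp
  then have "3 * l < 2 ^ k0" using l by (simp add: k0_def)
  define s where "s = max (3 * l) (8 * tile_N k0 + G + 2 * S)"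
  have "\<exists>t\<in>cube n s. tiling n k (v + t + g) \<noteq> tiling n k (v + t)" if v: "v \<in> lattice_Z n" for k v
  proof (cases "k \<le> k0")
    case True
    then have "8 * tile_N k + G + 2 * S \<le> s" using tile_N_mono[OF True] by (simp add: s_def)
    then show ?thesis using far[OF v, of k] cube_mono by blast
  next
    case False
    have "(2::int) ^ k0 \<le> 2 ^ k" "(0::int) < 2 ^ k"
      using False by (intro power_increasing) auto
    then have "3 * l \<le> tile_q k" using \<open>3 * l < 2 ^ k0\<close> unfolding tile_q_def by linarith
    moreover have "3 * l \<le> s" by (simp add: s_def)
    ultimately show ?thesis using near[OF v, of k] cube_mono by blast
  qed
  then show ?thesis by blast
qed

section \<open>The displacement cocycle\<close>

lemma along_add: "along i (a + b) = along i a + along i b"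
  by (auto simp: along_def fun_eq_iff)

lemma along_0: "along i 0 = 0"
  by (auto simp: along_def fun_eq_iff)

lemma along_1: "along i 1 = unit_vec i"
  by (auto simp: along_def unit_vec_def fun_eq_iff)

text \<open>The discrete Stokes formula: relations on unit squares add up, first along a strip and
  then over the strips.\<close>

lemma sum_rectangle:
  fixes h v :: "nat \<Rightarrow> nat \<Rightarrow> int"
  assumes "\<And>a b. h a b + v (Suc a) b = v a b + h a (Suc b)"
  shows "(\<Sum>a<A. h a 0) + (\<Sum>b<B. v A b) = (\<Sum>b<B. v 0 b) + (\<Sum>a<A. h a B)"
proof -
  have strip: "(\<Sum>a<A. h a b) + v A b = v 0 b + (\<Sum>a<A. h a (Suc b))" for b
  proof (induction A)
    case (Suc A)
    then show ?case using assms[of A b] by simp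
  qed simp
  show ?thesis
  proof (induction B)
    case (Suc B)
    then show ?case using strip[of B] by simp
  qed simp
qed

lemma sum_periodic:
  fixes h :: "nat \<Rightarrow> int"
  assumes "\<And>a. a < N \<Longrightarrow> h (a + p) = h a" "m * p \<le> N"
  shows "(\<Sum>a<m * p. h a) = int m * (\<Sum>a<p. h a)"
  using assms(2)
proof (induction m)
  case (Suc m)
  have "h (a + m' * p) = h a" if "m' \<le> m" "a < p" for a m'
    using that(1)
  proof (induction m')
    case (Suc m')
    have "a + m' * p < Suc m' * p" using that(2) by simp
    also have "\<dots> \<le> N" using Suc.prems Suc_leD[OF Suc.prems] \<open>Suc m * p \<le> N\<close>
      by (meson le_trans mult_le_mono1 Suc_le_mono le_SucI)
    finally show ?case using assms(1)[of "a + m' * p"] Suc by (simp add: ac_simps)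
  qed simp
  then have shift: "(\<Sum>a<p. h (a + m * p)) = (\<Sum>a<p. h a)" by (intro sum.cong) auto
  have "(\<Sum>a<k + l. h a) = (\<Sum>a<k. h a) + (\<Sum>a<l. h (a + k))" for k l
    by (induction l) (simp_all add: ac_simps)
  from this[of "m * p" p]
  show ?case using Suc shift by (simp add: algebra_simps)
qed simp

text \<open>Some coordinate of the sum is nonzero by parity, hence extremal.\<close>

lemma unit_steps_constant:
  assumes g: "\<And>a. a < p \<Longrightarrow> g a \<in> gens d" and p: "odd p"
    and dvd: "\<And>l. l < d \<Longrightarrow> int p dvd (\<Sum>a<p. g a l)"
    and ab: "a < p" "b < p"
  shows "g a = g b"
proof -
  have "odd (\<Sum>l<d. g a l)" if a: "a < p" for a
  proof -
    obtain i where i: "i < d" "g a = unit_vec i \<or> g a = - unit_vec i"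
      using g[OF a] by (auto simp: gens_def)
    then have "(\<Sum>l<d. g a l) = 1 \<or> (\<Sum>l<d. g a l) = - 1"
      by (auto simp: unit_vec_def sum_negf)
    then show ?thesis by auto
  qed
  then have "odd (\<Sum>a<p. \<Sum>l<d. g a l) \<longleftrightarrow> odd p"
    by (subst even_sum_iff) (auto cong: conj_cong)
  then have "odd (\<Sum>l<d. \<Sum>a<p. g a l)" using p by (subst sum.swap) simp
  then have "(\<Sum>l<d. \<Sum>a<p. g a l) \<noteq> 0" by auto
  then obtain l where l: "l < d" "(\<Sum>a<p. g a l) \<noteq> 0"
    by (metis (mono_tags, lifting) lessThan_iff sum.neutral)
  define S where "S = (\<Sum>a<p. g a l)"
  have "int p \<le> \<bar>S\<bar>" using dvd[OF l(1)] l(2) unfolding S_def[symmetric] by (intro zdvd_imp_le) auto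
  \<comment> \<open>\<open>p\<close> terms in the interval from -1 to 1 whose sum has absolute value
    at least \<open>p\<close> must all equal the sign of that sum.\<close>
  have key: "g a l = sgn S" if a: "a < p" for a
  proof -
    have le: "sgn S * g b l \<le> 1" if "b < p" for b
      using gens_abs_le[OF g[OF that], of l] by (auto simp: sgn_if)
    have "\<bar>S\<bar> = (\<Sum>b<p. sgn S * g b l)" unfolding S_def sum_distrib_left[symmetric] by (simp add: abs_sgn ac_simps)
    also have "\<dots> = sgn S * g a l + (\<Sum>b\<in>{..<p} - {a}. sgn S * g b l)"
      using a by (subst sum.remove[of _ a]) auto
    also have "(\<Sum>b\<in>{..<p} - {a}. sgn S * g b l) \<le> (\<Sum>b\<in>{..<p} - {a}. 1)"
      using le by (intro sum_mono) auto
    also have "\<dots> = int p - 1" using a by (simp add: of_nat_diff)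
    finally have "sgn S * g a l \<ge> 1" using \<open>int p \<le> \<bar>S\<bar>\<close> by simp
    then show ?thesis using gens_abs_le[OF g[OF a], of l] by (auto simp: sgn_if split: if_splits)
  qed
  have "sgn S \<noteq> 0" using l by (simp add: S_def sgn_0_0)
  have "g a = (\<lambda>j. sgn S * unit_vec l j)" if a: "a < p" for a
  proof -
    obtain i where i: "g a = unit_vec i \<or> g a = - unit_vec i"
      using g[OF a] by (auto simp: gens_def)
    then have "i = l"
      using key[OF a] \<open>sgn S \<noteq> 0\<close> by (rule_tac ccontr) (auto simp: unit_vec_def)
    with i key[OF a, symmetric] show ?thesis by (auto simp: unit_vec_def)
  qed
  then show ?thesis using ab by simp
qed

text \<open>\<open>f u\<close> models the colour of the translate by \<open>u\<close> of one fixed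
  configuration.\<close>

locale net_walk =
  fixes d n :: nat and L :: int and f :: "(nat \<Rightarrow> int) \<Rightarrow> (nat \<Rightarrow> int) set"
  assumes d: "d \<ge> 1" and L: "L \<ge> 4"
    and verts: "u \<in> lattice_Z n \<Longrightarrow> f u \<in> M_verts d L"
    and edge: "u \<in> lattice_Z n \<Longrightarrow> i < n \<Longrightarrow> (f u, f (u + unit_vec i)) \<in> parcs (M_graph d L)"
begin

text \<open>The choice depends only on the two end vertices of the edge, so \<open>step\<close>
  inherits every period of \<open>f\<close>.\<close>

definition step :: "nat \<Rightarrow> (nat \<Rightarrow> int) \<Rightarrow> nat \<Rightarrow> int" where
  "step i u = (SOME g. g \<in> gens d \<and> overlap d L g (f u) (f (u + unit_vec i)))"

lemma step:
  assumes "u \<in> lattice_Z n" "i < n"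
  shows "step i u \<in> gens d" "overlap d L (step i u) (f u) (f (u + unit_vec i))"
proof -
  have "\<exists>g. g \<in> gens d \<and> overlap d L g (f u) (f (u + unit_vec i))"
    using edge[OF assms] unfolding parcs_M_graph by blast
  from someI_ex[OF this] show "step i u \<in> gens d" "overlap d L (step i u) (f u) (f (u + unit_vec i))"
    unfolding step_def by auto
qed

lemma step_cong:
  "f u = f u' \<Longrightarrow> f (u + unit_vec i) = f (u' + unit_vec i) \<Longrightarrow> step i u = step i u'"
  by (simp add: step_def)

text \<open>Following a net point across an edge costs one unit of distance from the origin, which
  is affordable while it stays in the large cube.\<close>

lemma move:
  assumes "u \<in> lattice_Z n" "overlap d L g (f u) E" "x \<in> f u" "x \<in> cube d r" "g \<in> gens d" "r + 1 \<le> 2 * L"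
  shows "x - g \<in> E" "x - g \<in> cube d (r + 1)"
  using overlapD[OF assms(2,3) cube_diff_gens[OF assms(4-6)] M_vertsD(1)[OF verts[OF assms(1)] d]]
    cube_diff_gens[OF assms(4,5) order_refl]
  by auto

text \<open>A point of a net near the origin is followed around the square; both ways around lead to points
  of the same net at distance at most 4.\<close>

lemma square:
  assumes u: "u \<in> lattice_Z n" and i: "i < n" and j: "j < n"
  shows "step i u + step j (u + unit_vec i) = step j u + step i (u + unit_vec j)"
proof -
  obtain x where x: "x \<in> f u" "x \<in> cube d L"
    using M_verts_central[OF verts[OF u] d] L by auto
  have two: "x - step i u - step j (u + unit_vec i) \<in> f (u + unit_vec i + unit_vec j)"
    if i: "i < n" and j: "j < n" for i j
  proof -
    have ui: "u + unit_vec i \<in> lattice_Z n" using u i by (intro lattice_Z_intros)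
    note 1 = move[OF u step(2)[OF u i] x step(1)[OF u i]]
    note 2 = move[OF ui step(2)[OF ui j] 1(1) 1(2) step(1)[OF ui j]]
    show ?thesis using 2 L by auto
  qed
  let ?a = "x - step i u - step j (u + unit_vec i)" and ?b = "x - step j u - step i (u + unit_vec j)"
  let ?w = "u + unit_vec i + unit_vec j"
  have lat: "u + unit_vec i \<in> lattice_Z n" "u + unit_vec j \<in> lattice_Z n" "?w \<in> lattice_Z n"
    using u i j by (auto intro!: lattice_Z_intros)
  have "?a \<in> f ?w" using two[OF i j] .
  moreover have "?b \<in> f ?w" using two[OF j i] by (simp add: ac_simps)
  moreover have "\<bar>?a l - ?b l\<bar> \<le> L" for l
    using gens_abs_le[OF step(1)[OF u i], of l] gens_abs_le[OF step(1)[OF u j], of l]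
      gens_abs_le[OF step(1)[OF lat(1) j], of l] gens_abs_le[OF step(1)[OF lat(2) i], of l] L
    by simp
  ultimately have "?a = ?b" using M_vertsD(2)[OF verts[OF lat(3)] d] by blast
  then show ?thesis by (simp add: algebra_simps diff_eq_eq)
qed

lemma rectangle:
  assumes u: "u \<in> lattice_Z n" and i: "i < n" and j: "j < n"
  shows "(\<Sum>a<A. step i (u + along i (int a)) l) + (\<Sum>b<B. step j (u + along i (int A) + along j (int b)) l) =
    (\<Sum>b<B. step j (u + along j (int b)) l) + (\<Sum>a<A. step i (u + along j (int B) + along i (int a)) l)"
proof -
  have "step i (u + along i (int a) + along j (int b)) l + step j (u + along i (int (Suc a)) + along j (int b)) l =
    step j (u + along i (int a) + along j (int b)) l + step i (u + along i (int a) + along j (int (Suc b))) l" for a b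
  proof -
    let ?v = "u + along i (int a) + along j (int b)"
    have "?v \<in> lattice_Z n" using u i j by (intro lattice_Z_add along_lattice_Z)
    from fun_cong[OF square[OF this i j], of l] show ?thesis
      by (simp add: along_add along_1 ac_simps)
  qed
  from sum_rectangle[of "\<lambda>a b. step i (u + along i (int a) + along j (int b)) l"
      "\<lambda>a b. step j (u + along i (int a) + along j (int b)) l", OF this, of A B]
  show ?thesis by (simp add: along_0 ac_simps)
qed

text \<open>In a rectangle of length \<open>p * q\<close> the bottom sums to \<open>q\<close> times
  its sum over one period, the top to \<open>p\<close> times its own, and the two vertical sides
  agree. Coprimality makes \<open>p\<close> divide the bottom sum over one period, and
  \<open>unit_steps_constant\<close> applies. The bound on \<open>a\<close> includes
  \<open>p * q\<close> because a step involves both ends of its edge.\<close>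

lemma slope_constant:
  fixes p q M :: nat
  assumes u: "u \<in> lattice_Z n" and i: "i < n" and j: "j < n"
    and pq: "coprime p q" "odd p"
    and per_p: "\<And>a. a \<le> p * q \<Longrightarrow> f (u + along i (int (a + p))) = f (u + along i (int a))"
    and per_q: "\<And>a. a \<le> p * q \<Longrightarrow>
      f (u + along j (int M) + along i (int (a + q))) = f (u + along j (int M) + along i (int a))"
    and conn: "\<And>b. b \<le> M \<Longrightarrow> f (u + along i (int (p * q)) + along j (int b)) = f (u + along j (int b))"
    and a: "a < p"
  shows "step i (u + along i (int a)) = step i u"
proof -
  have succ: "v + along l (int (Suc b)) = v + along l (int b) + unit_vec l" for v l b
    by (simp add: along_add along_1 ac_simps)
  have dvd: "int p dvd (\<Sum>a<p. step i (u + along i (int a)) l)" for l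
  proof -
    have "(\<Sum>a<q * p. step i (u + along i (int a)) l) = int q * (\<Sum>a<p. step i (u + along i (int a)) l)"
    proof (rule sum_periodic)
      fix a assume "a < p * q"
      then have "step i (u + along i (int (a + p))) = step i (u + along i (int a))"
        using per_p[of a] per_p[of "Suc a", unfolded add_Suc succ] by (intro step_cong) auto
      then show "step i (u + along i (int (a + p))) l = step i (u + along i (int a)) l" by simp
    qed simp
    moreover have "(\<Sum>a<p * q. step i (u + along j (int M) + along i (int a)) l) =
        int p * (\<Sum>a<q. step i (u + along j (int M) + along i (int a)) l)"
    proof (rule sum_periodic)
      fix a assume "a < p * q"
      then have "step i (u + along j (int M) + along i (int (a + q))) = step i (u + along j (int M) + along i (int a))"
        using per_q[of a] per_q[of "Suc a", unfolded add_Suc succ] by (intro step_cong) auto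
      then show "step i (u + along j (int M) + along i (int (a + q))) l = step i (u + along j (int M) + along i (int a)) l" by simp
    qed simp
    moreover have "(\<Sum>b<M. step j (u + along i (int (p * q)) + along j (int b)) l) = (\<Sum>b<M. step j (u + along j (int b)) l)"
    proof (intro sum.cong refl)
      fix b assume "b \<in> {..<M}"
      then have "step j (u + along i (int (p * q)) + along j (int b)) = step j (u + along j (int b))"
        using conn[of b] conn[of "Suc b", unfolded succ[of _ j]] by (intro step_cong) auto
      then show "step j (u + along i (int (p * q)) + along j (int b)) l = step j (u + along j (int b)) l" by simp
    qed
    ultimately have "int q * (\<Sum>a<p. step i (u + along i (int a)) l) =
        int p * (\<Sum>a<q. step i (u + along j (int M) + along i (int a)) l)"
      using rectangle[OF u i j, where A = "p * q" and B = M and l = l] by (simp add: mult.commute)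
    then have "int p dvd int q * (\<Sum>a<p. step i (u + along i (int a)) l)" by simp
    then show ?thesis using pq(1) by (simp add: coprime_dvd_mult_right_iff)
  qed
  have "step i (u + along i (int a)) = step i (u + along i (int 0))"
    using a dvd pq(2) by (intro unit_steps_constant[where d = d and p = p and g = "\<lambda>a. step i (u + along i (int a))"]
      step(1) lattice_Z_add along_lattice_Z u i) auto
  then show ?thesis by (simp add: along_0)
qed

text \<open>In a strip of length \<open>p\<close> and width 1 the short sides carry equal steps, so
  the long sides have equal sums, namely \<open>p\<close> times their constant steps.\<close>

lemma step_transport:
  fixes p :: nat
  assumes u: "u \<in> lattice_Z n" and i: "i < n" and j: "j < n" and p: "p > 0"
    and const: "\<And>a. a < p \<Longrightarrow> step i (u + along i (int a)) = step i u"
      "\<And>a. a < p \<Longrightarrow> step i (u + unit_vec j + along i (int a)) = step i (u + unit_vec j)"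
    and per: "f (u + along i (int p)) = f u" "f (u + unit_vec j + along i (int p)) = f (u + unit_vec j)"
  shows "step i (u + unit_vec j) = step i u"
proof
  fix l
  have "step j (u + along i (int p)) = step j u"
    using per by (intro step_cong) (simp_all add: ac_simps)
  then show "step i (u + unit_vec j) l = step i u l"
    using rectangle[OF u i j, where A = p and B = 1 and l = l] const p
    by (simp add: along_0 along_1)
qed

end

section \<open>Parallel directions in the tiled region\<close>

lemma constant_on_interval:
  fixes F :: "int \<Rightarrow> 'a"
  assumes F: "\<And>x. - N \<le> x \<Longrightarrow> x < N \<Longrightarrow> F (x + 1) = F x" and x: "\<bar>x\<bar> \<le> N"
  shows "F x = F 0"
proof -
  have "y \<le> N \<longrightarrow> F y = F (- N)" if "- N \<le> y" for y
    using that by (induction y rule: int_ge_induct) (auto simp: F)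
  then show ?thesis using x by (metis abs_ge_zero abs_le_iff minus_le_iff neg_le_0_iff_le order_trans)
qed

lemma mod_add_dvd: "m dvd b \<Longrightarrow> (a + b) mod m = a mod (m :: int)"
  by (auto elim!: dvdE)

text \<open>If two of the \<open>n\<close> directions move the net in parallel, zigzagging between them fixes a point of the
  net close to the origin; one further step displaces it by a unit vector.\<close>

lemma (in net_walk) zigzag:
  fixes M :: nat and R :: int
  assumes a: "a \<in> lattice_Z n" and i: "i < n" and j: "j < n" and w: "w \<in> gens d"
    and flat_i: "\<And>x y. \<bar>x\<bar> \<le> R \<Longrightarrow> \<bar>y\<bar> \<le> R \<Longrightarrow> step i (a + along i x + along j y) = w"
    and flat_j: "\<And>x y. \<bar>x\<bar> \<le> R \<Longrightarrow> \<bar>y\<bar> \<le> R \<Longrightarrow> step j (a + along i x + along j y) = (if pos then w else - w)"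
    and R: "int M + 1 \<le> R"
  shows "f (a + along i (- int (Suc M)) + along j (if pos then int M else - int M)) \<noteq> f a"
proof
  obtain z where z: "z \<in> f a" "z \<in> cube d L" using M_verts_central[OF verts[OF a] d] L by auto
  define s where "s = (\<lambda>m. if pos then int m else - int m)"
  define U where "U = (\<lambda>m. a + along i (- int m) + along j (s m))"
  define U' where "U' = (\<lambda>m. a + along i (- int (Suc m)) + along j (s m))"
  have lat: "U m \<in> lattice_Z n" "U' m \<in> lattice_Z n" for m
    unfolding U_def U'_def using a i j by (auto intro!: lattice_Z_add along_lattice_Z)
  \<comment> \<open>Going back one step in direction \<open>i\<close> displaces the point by
    \<open>w\<close>; the following move in direction \<open>j\<close> undoes this
    displacement.\<close>
  have half: "z + w \<in> f (U' m) \<and> z + w \<in> cube d (L + 1)" if "z \<in> f (U m)" "m \<le> M" for m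
  proof -
    have "step i (U' m) = w"
      unfolding U'_def s_def using that R by (intro flat_i) auto
    moreover have "U' m + unit_vec i = U m"
      by (auto simp: U'_def U_def along_def unit_vec_def fun_eq_iff)
    ultimately have "overlap d L w (f (U' m)) (f (U m))" using step(2)[OF lat(2) i, of m] by simp
    from move[OF lat(1) overlap_sym[OF this] that(1) z(2) gens_uminus[OF w]] show ?thesis
      using L by simp
  qed
  have "z \<in> f (U m)" if "m \<le> M" for m
    using that
  proof (induction m)
    case 0
    then show ?case using z by (simp add: U_def s_def along_0)
  next
    case (Suc m)
    then have h: "z + w \<in> f (U' m)" "z + w \<in> cube d (L + 1)" using half[of m] by auto
    have "overlap d L w (f (U' m)) (f (U (Suc m)))"
    proof (cases pos)
      case True
      have "step j (U' m) = (if pos then w else - w)"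
        unfolding U'_def s_def using Suc.prems R by (intro flat_j) auto
      moreover have "U' m + unit_vec j = U (Suc m)"
        using True by (auto simp: U'_def U_def s_def along_def unit_vec_def fun_eq_iff)
      ultimately show ?thesis using step(2)[OF lat(2) j, of m] True by simp
    next
      case False
      have "step j (U (Suc m)) = (if pos then w else - w)"
        unfolding U_def s_def using Suc.prems R by (intro flat_j) auto
      moreover have "U (Suc m) + unit_vec j = U' m"
        using False by (auto simp: U'_def U_def s_def along_def unit_vec_def fun_eq_iff)
      ultimately have "overlap d L (- w) (f (U (Suc m))) (f (U' m))"
        using step(2)[OF lat(1) j, of "Suc m"] False by simp
      from overlap_sym[OF this] show ?thesis by simp
    qed
    from move(1)[OF lat(2) this h w] show ?case using L by simp
  qed
  from half[OF this] have "z + w \<in> f (U' M)" by simp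
  moreover assume "f (a + along i (- int (Suc M)) + along j (if pos then int M else - int M)) = f a"
  ultimately have "z + w \<in> f a" by (simp add: U'_def s_def)
  moreover have "\<bar>(z + w) l - z l\<bar> \<le> L" for l using gens_abs_le[OF w, of l] L by simp
  ultimately have "z + w = z" using M_vertsD(2)[OF verts[OF a] d] z(1) by blast
  then show False using gens_nonzero[OF w] by simp
qed

text \<open>The colours now come from the tiling, seen through a window of radius \<open>r\<close>.
  The bound on \<open>r\<close> keeps the window smaller than half of a tile.\<close>

locale tiled_walk = net_walk +
  fixes k :: nat and r :: int
  assumes n: "n \<ge> 2" and r: "0 \<le> r" "r < 2 ^ k"
    and window: "u \<in> lattice_Z n \<Longrightarrow> u' \<in> lattice_Z n \<Longrightarrow>
      (\<And>t. t \<in> cube n r \<Longrightarrow> tiling n k (u + t) = tiling n k (u' + t)) \<Longrightarrow> f u = f u'"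
begin

abbreviation "H \<equiv> (2::int) ^ k"
abbreviation "p \<equiv> tile_p k"
abbreviation "q \<equiv> tile_q k"
abbreviation "N \<equiv> tile_N k"

lemma sizes: "H \<ge> 1" "p = 4 * H + 1" "q = 4 * H" "N = p * q" "20 * H \<le> N"
proof -
  show H: "H \<ge> 1" by simp
  show "p = 4 * H + 1" "q = 4 * H" "N = p * q" by (simp_all add: tile_p_def tile_q_def tile_N_def)
  have "20 * H = 20 * (H * 1)" by simp
  also have "\<dots> \<le> 16 * (H * H) + 4 * H" using mult_left_mono[OF H, of H] by simp
  also have "\<dots> = N" by (simp add: tile_p_def tile_q_def tile_N_def algebra_simps)
  finally show "20 * H \<le> N" .
qed

text \<open>All residues seen through the window survive the translation: both copies stay in the
  box, no position changes its region, and \<open>m\<close> is a multiple of the period in force at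
  each position.\<close>

lemma f_periodic:
  assumes u: "u \<in> lattice_Z n" and i: "i < n"
    and box: "\<And>l. l < n \<Longrightarrow> - 8 * N + r \<le> u l \<and> u l + r < 8 * N"
      "- 8 * N + r \<le> u i + m" "u i + m + r < 8 * N"
    and type: "\<And>t. t \<in> cube n r \<Longrightarrow>
      (u 0 + t 0 + along i m 0 < 0 \<and> u 1 + t 1 + along i m 1 < 0) = (u 0 + t 0 < 0 \<and> u 1 + t 1 < 0)"
    and dvd: "\<And>t. t \<in> cube n r \<Longrightarrow> (if u 0 + t 0 < 0 \<and> u 1 + t 1 < 0 then p else q) dvd m"
  shows "f (u + along i m) = f u"
proof (rule window)
  fix t assume t: "t \<in> cube n r"
  then have tl: "t \<in> lattice_Z n" using cube_subset_lattice_Z by blast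
  define P where "P = (if u 0 + t 0 < 0 \<and> u 1 + t 1 < 0 then p else q)"
  have lat: "u + along i m + t \<in> lattice_Z n" "u + t \<in> lattice_Z n"
    using u tl i by (auto intro!: lattice_Z_add along_lattice_Z)
  have b: "- (8 * N) \<le> u l + t l" "u l + t l < 8 * N" if "l < n" for l
    using box(1)[OF that] cube_abs_le[OF t that] by auto
  have b': "- (8 * N) \<le> u l + along i m l + t l" "u l + along i m l + t l < 8 * N" if "l < n" for l
    using b[OF that] box(2,3) cube_abs_le[OF t i] by (auto simp: along_simps)
  have "tiling n k (u + t) = toeplitz_sum n (\<lambda>l. (u l + t l) mod P)"
    using lat b by (simp add: tiling_def tiled_def P_def)
  moreover have "tiling n k (u + along i m + t) = toeplitz_sum n (\<lambda>l. (u l + along i m l + t l) mod P)"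
    using lat b' type[OF t] by (simp add: tiling_def tiled_def P_def add.commute add.left_commute)
  moreover have "(u l + along i m l + t l) mod P = (u l + t l) mod P" for l
    using mod_add_dvd[of P m "u l + t l"] dvd[OF t, folded P_def]
    by (cases "l = i") (auto simp: along_simps ac_simps)
  ultimately show "tiling n k (u + along i m + t) = tiling n k (u + t)" by simp
qed (use u i in \<open>auto intro!: lattice_Z_add along_lattice_Z\<close>)

lemma f_periodic_p:
  assumes u: "u \<in> lattice_Z n" and i: "i < n"
    and neg: "\<And>l. l < n \<Longrightarrow> - 8 * N + r \<le> u l \<and> u l + r < 0" "u i + p + r < 0"
  shows "f (u + along i p) = f u"
proof (rule f_periodic[OF u i])
  have N: "N > 0" by (rule tile_pos)
  have p: "p > 0" by (rule tile_pos)
  show "- 8 * N + r \<le> u l \<and> u l + r < 8 * N" if "l < n" for l using neg(1)[OF that] N by simp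
  show "- 8 * N + r \<le> u i + p" "u i + p + r < 8 * N" using neg(1)[OF i] neg(2) N p by auto
  fix t assume t: "t \<in> cube n r"
  have "u l + t l < 0" "u l + t l + along i p l < 0" if "l < n" for l
    using neg(1)[OF that] neg(2) cube_abs_le[OF t that] by (auto simp: along_simps)
  from this[of 0] this[of 1] n
  show "(u 0 + t 0 + along i p 0 < 0 \<and> u 1 + t 1 + along i p 1 < 0) = (u 0 + t 0 < 0 \<and> u 1 + t 1 < 0)"
    "(if u 0 + t 0 < 0 \<and> u 1 + t 1 < 0 then p else q) dvd p"
    by auto
qed

text \<open>Coordinate \<open>j\<close> stays nonnegative in the whole window, and the translation
  does not touch it, so only the period \<open>q\<close> is met.\<close>

lemma f_periodic_q:
  assumes u: "u \<in> lattice_Z n" and i: "i < n" and j: "j \<in> {0, 1}" "i \<noteq> j"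
    and box: "\<And>l. l < n \<Longrightarrow> - 8 * N + r \<le> u l \<and> u l + r < 8 * N" "u i + q + r < 8 * N"
    and pos: "r \<le> u j"
  shows "f (u + along i q) = f u"
proof (rule f_periodic[OF u i])
  have q: "q > 0" by (rule tile_pos)
  show "- 8 * N + r \<le> u l \<and> u l + r < 8 * N" if "l < n" for l using box(1)[OF that] .
  show "- 8 * N + r \<le> u i + q" "u i + q + r < 8 * N" using box(1)[OF i] box(2) q by auto
  fix t assume t: "t \<in> cube n r"
  have "0 \<le> u j + t j" "along i q j = 0"
    using pos cube_abs_le[OF t, of j] j n by (auto simp: along_simps)
  then show "(u 0 + t 0 + along i q 0 < 0 \<and> u 1 + t 1 + along i q 1 < 0) = (u 0 + t 0 < 0 \<and> u 1 + t 1 < 0)"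
    "(if u 0 + t 0 < 0 \<and> u 1 + t 1 < 0 then p else q) dvd q"
    using j by auto
qed

text \<open>The window may straddle both regions: \<open>N\<close> is a multiple of both periods,
  and coordinate \<open>i\<close> remains negative throughout.\<close>

lemma f_periodic_N:
  assumes u: "u \<in> lattice_Z n" and i: "i < n"
    and box: "\<And>l. l < n \<Longrightarrow> - 8 * N + r \<le> u l \<and> u l + r < 8 * N"
    and neg: "u i + N + r < 0"
  shows "f (u + along i N) = f u"
proof (rule f_periodic[OF u i])
  have N: "N > 0" by (rule tile_pos)
  show "- 8 * N + r \<le> u l \<and> u l + r < 8 * N" if "l < n" for l using box(1)[OF that] .
  show "- 8 * N + r \<le> u i + N" "u i + N + r < 8 * N" using box(1)[OF i] neg N by auto
  fix t assume t: "t \<in> cube n r"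
  have "u i + t i < 0" "u i + t i + N < 0"
    using neg N cube_abs_le[OF t i] by auto
  then show "(u 0 + t 0 + along i N 0 < 0 \<and> u 1 + t 1 + along i N 1 < 0) = (u 0 + t 0 < 0 \<and> u 1 + t 1 < 0)"
    by (auto simp: along_simps)
  show "(if u 0 + t 0 < 0 \<and> u 1 + t 1 < 0 then p else q) dvd N"
    by (simp add: tile_N_def)
qed

text \<open>The margin \<open>2 * N\<close> to the box and to the coordinate hyperplanes leaves room
  for segments of length \<open>N + p\<close> and the windows around them.\<close>

definition core :: "(nat \<Rightarrow> int) set" where
  "core = {u \<in> lattice_Z n. \<forall>l<n. - 6 * N \<le> u l \<and> u l \<le> - 2 * N}"

text \<open>The rectangle for \<open>slope_constant\<close> has height \<open>8 * N\<close> in a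
  direction \<open>j\<close> among 0 and 1 other than \<open>i\<close>. This takes coordinate
  \<open>j\<close> from negative values to at least \<open>2 * N\<close>, into the
  \<open>q\<close>-region; the two vertical sides agree by \<open>f_periodic_N\<close>.\<close>

lemma step_core_line:
  assumes u: "u \<in> core" and i: "i < n" and a: "a < nat p"
  shows "step i (u + along i (int a)) = step i u"
proof -
  define j :: nat where "j = (if i = 0 then 1 else 0)"
  have j: "j < n" "j \<in> {0, 1}" "i \<noteq> j" using n by (auto simp: j_def)
  have uL: "u \<in> lattice_Z n" and ub: "\<And>l. l < n \<Longrightarrow> - 6 * N \<le> u l \<and> u l \<le> - 2 * N"
    using u by (auto simp: core_def)
  have int: "int (nat p) = p" "int (nat q) = q" "int (nat (8 * N)) = 8 * N"
    using tile_pos[of k] by auto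
  have intN: "int (nat p * nat q) = N"
    by (simp only: of_nat_mult int sizes(4))
  have bounds: "p + r < N" "q + r < N" "r < N" "p > 0" "q > 0"
    using sizes(1,2,3,5) r by linarith+
  have le_N: "int a \<le> N" if "a \<le> nat p * nat q" for a using that intN by linarith
  show ?thesis
  proof (rule slope_constant[OF uL i j(1), where q = "nat q" and M = "nat (8 * N)"])
    have "coprime p q" unfolding sizes(2,3) by (rule coprime_add_one_left)
    then show "coprime (nat p) (nat q)" using int by (metis coprime_int_iff)
    have "odd p" using sizes(2) by simp
    then show "odd (nat p)" using int(1) by (metis even_of_nat)
    show "a < nat p" by fact
  next
    fix a assume "a \<le> nat p * nat q"
    note a = le_N[OF this]
    have "f (u + along i (int a) + along i p) = f (u + along i (int a))"
    proof (rule f_periodic_p[OF _ i])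
      show "u + along i (int a) \<in> lattice_Z n" using uL i by (intro lattice_Z_add along_lattice_Z)
      show "- 8 * N + r \<le> (u + along i (int a)) l \<and> (u + along i (int a)) l + r < 0" if "l < n" for l
        using ub[OF that] a bounds by (auto simp: along_simps)
      show "(u + along i (int a)) i + p + r < 0"
        using ub[OF i] a bounds by (auto simp: along_simps)
    qed
    then show "f (u + along i (int (a + nat p))) = f (u + along i (int a))"
      unfolding of_nat_add int along_add by (simp only: ac_simps)
  next
    fix a assume "a \<le> nat p * nat q"
    note a = le_N[OF this]
    let ?v = "u + along j (8 * N) + along i (int a)"
    have "f (?v + along i q) = f ?v"
    proof (rule f_periodic_q[OF _ i j(2,3)])
      show "?v \<in> lattice_Z n" using uL i j(1) by (intro lattice_Z_add along_lattice_Z)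
      show "- 8 * N + r \<le> ?v l \<and> ?v l + r < 8 * N" if "l < n" for l
        using ub[OF that] a bounds j(3) by (auto simp: along_simps)
      show "?v i + q + r < 8 * N"
        using ub[OF i] a bounds j(3) by (auto simp: along_simps)
      show "r \<le> ?v j" using ub[OF j(1)] bounds j(3) by (auto simp: along_simps)
    qed
    then show "f (u + along j (int (nat (8 * N))) + along i (int (a + nat q))) =
        f (u + along j (int (nat (8 * N))) + along i (int a))"
      unfolding of_nat_add int along_add by (simp only: ac_simps)
  next
    fix b assume "b \<le> nat (8 * N)"
    then have b: "int b \<le> 8 * N" using int(3) by linarith
    let ?v = "u + along j (int b)"
    have "f (?v + along i N) = f ?v"
    proof (rule f_periodic_N[OF _ i])
      show "?v \<in> lattice_Z n" using uL j(1) by (intro lattice_Z_add along_lattice_Z)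
      show "- 8 * N + r \<le> ?v l \<and> ?v l + r < 8 * N" if "l < n" for l
        using ub[OF that] b bounds by (auto simp: along_simps)
      show "?v i + N + r < 0" using ub[OF i] bounds j(3) by (auto simp: along_simps)
    qed
    then show "f (u + along i (int (nat p * nat q)) + along j (int b)) = f (u + along j (int b))"
      unfolding intN by (simp add: ac_simps)
  qed
qed

lemma step_core:
  assumes u: "u \<in> core" "u + unit_vec j \<in> core" and i: "i < n" and j: "j < n"
  shows "step i (u + unit_vec j) = step i u"
proof (rule step_transport[OF _ i j, where p = "nat p"])
  have per: "f (v + along i (int (nat p))) = f v" if "v \<in> core" for v
  proof -
    have "f (v + along i p) = f v"
    proof (rule f_periodic_p[OF _ i])
      have b: "- 6 * N \<le> v l \<and> v l \<le> - 2 * N" if "l < n" for l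
        using \<open>v \<in> core\<close> that by (auto simp: core_def)
      show "v \<in> lattice_Z n" using that by (simp add: core_def)
      show "- 8 * N + r \<le> v l \<and> v l + r < 0" if "l < n" for l
        using b[OF that] sizes(1,5) r by linarith
      show "v i + p + r < 0" using b[OF i] sizes(1,2,5) r by linarith
    qed
    then show ?thesis using tile_pos(1)[of k] by simp
  qed
  show "f (u + along i (int (nat p))) = f u"
    "f (u + unit_vec j + along i (int (nat p))) = f (u + unit_vec j)"
    using per u by auto
  show "u \<in> lattice_Z n" using u by (simp add: core_def)
qed (use step_core_line u i tile_pos(1)[of k] in auto)

text \<open>Every coordinate has residue \<open>H\<close> modulo \<open>p\<close>. As
  \<open>r < H\<close>, the window around it sees only residues strictly between 0 and
  \<open>2 * H\<close>, in the first half of a tile.\<close>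

definition center :: "nat \<Rightarrow> int" where
  "center = (\<lambda>l. if l < n then - 4 * N + H else 0)"

lemma center_lattice_Z: "center \<in> lattice_Z n"
  by (simp add: center_def lattice_Z_def)

lemma step_plane:
  assumes ij: "i < n" "j < n" "i \<noteq> j" and l: "l < n" and xy: "\<bar>x\<bar> \<le> N" "\<bar>y\<bar> \<le> N"
  shows "step l (center + along i x + along j y) = step l center"
proof -
  have core: "center + along i x + along j y \<in> core" if "\<bar>x\<bar> \<le> N" "\<bar>y\<bar> \<le> N" for x y
    unfolding core_def
  proof (intro CollectI conjI allI impI lattice_Z_add along_lattice_Z center_lattice_Z ij)
    fix m assume "m < n"
    then show "- 6 * N \<le> (center + along i x + along j y) m" "(center + along i x + along j y) m \<le> - 2 * N"
      using that sizes(5) r ij(3) by (auto simp: along_simps center_def)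
  qed
  have "step l (center + along i (x + 1) + along j y) = step l (center + along i x + along j y)"
    if "- N \<le> x" "x < N" "\<bar>y\<bar> \<le> N" for x y
  proof -
    have eq: "center + along i x + along j y + unit_vec i = center + along i (x + 1) + along j y"
      by (simp add: along_add along_1 ac_simps)
    then show ?thesis using step_core[OF core _ l ij(1), of x y] core[of "x + 1" y] that unfolding eq by simp
  qed
  from constant_on_interval[of N "\<lambda>x. step l (center + along i x + along j y)", OF this[OF _ _ xy(2)] xy(1)]
  have "step l (center + along i x + along j y) = step l (center + along j y)"
    by (simp add: along_0)
  moreover have "step l (center + along j (y + 1)) = step l (center + along j y)" if "- N \<le> y" "y < N" for y
  proof -
    have eq: "center + along j y + unit_vec j = center + along j (y + 1)"
      by (simp add: along_add along_1 ac_simps)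
    then show ?thesis
      using step_core[OF _ _ l ij(2), of "center + along j y"] core[of 0 y] core[of 0 "y + 1"] that
      unfolding eq by (simp add: along_0)
  qed
  from constant_on_interval[of N "\<lambda>y. step l (center + along j y)", OF this xy(2)]
  have "step l (center + along j y) = step l center" by (simp add: along_0)
  ultimately show ?thesis by simp
qed

text \<open>Adding \<open>2 * H\<close>, which is \<open>2 ^ (k + 1)\<close>, to a number strictly
  between 0 and \<open>2 * H\<close> preserves its 2-adic valuation. The shifted window still fits
  into the same tile because \<open>3 * H + r < p\<close>.\<close>

lemma f_center_shift:
  assumes ij: "i < n" "j < n" "i \<noteq> j" and xy: "x \<in> {0, 2 * H}" "y \<in> {0, 2 * H}"
  shows "f (center + along i x + along j y) = f center"
proof (rule window)
  fix t assume t: "t \<in> cube n r"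
  then have tl: "t \<in> lattice_Z n" using cube_subset_lattice_Z by blast
  have tile: "tiling n k (center + c + t) = toeplitz_sum n (\<lambda>l. H + c l + t l)"
    if c: "c \<in> lattice_Z n" "\<And>l. l < n \<Longrightarrow> c l \<in> {0, 2 * H}" for c
  proof -
    have lat: "center + c + t \<in> lattice_Z n" using c tl by (intro lattice_Z_add center_lattice_Z)
    have b: "0 < H + c l + t l" "H + c l + t l < p" if "l < n" for l
      using c(2)[OF that] cube_abs_le[OF t that] r sizes(2) by auto
    have b': "- (8 * N) \<le> center l + c l + t l" "center l + c l + t l < 0" "center l + c l + t l < 8 * N"
      "(center l + c l + t l) mod p = H + c l + t l" if "l < n" for l
    proof -
      have "p \<le> N" using sizes(1,2,5) by linarith
      then show "- (8 * N) \<le> center l + c l + t l" "center l + c l + t l < 0" "center l + c l + t l < 8 * N"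
        using b[OF that] that by (auto simp: center_def)
      have "center l + c l + t l = H + c l + t l + - 4 * N" using that by (simp add: center_def)
      also have "\<dots> mod p = (H + c l + t l) mod p" by (rule mod_add_dvd) (simp add: tile_N_def)
      also have "\<dots> = H + c l + t l" using b[OF that] by simp
      finally show "(center l + c l + t l) mod p = H + c l + t l" .
    qed
    have "tiling n k (center + c + t) = toeplitz_sum n (\<lambda>l. (center l + c l + t l) mod p)"
      using lat b'(1,2,3) n b'(2)[of 0] b'(2)[of 1] by (simp add: tiling_def tiled_def)
    also have "\<dots> = toeplitz_sum n (\<lambda>l. H + c l + t l)"
      by (rule toeplitz_sum_cong) (simp add: b'(4))
    finally show ?thesis .
  qed
  have "tiling n k (center + (along i x + along j y) + t) =
      toeplitz_sum n (\<lambda>l. H + (along i x + along j y) l + t l)"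
    using xy ij by (intro tile lattice_Z_add along_lattice_Z) (auto simp: along_simps)
  also have "\<dots> = toeplitz_sum n (\<lambda>l. H + 0 l + t l)"
  proof (rule toeplitz_sum_cong)
    fix l assume l: "l < n"
    have h: "0 < H + t l" "H + t l < 2 * H" using cube_abs_le[OF t l] r by auto
    have val: "multiplicity 2 (a + 2 * H) = multiplicity 2 a" if a: "0 < a" "a < 2 * H" for a :: int
    proof -
      have "2 ^ m dvd a + 2 ^ Suc k \<longleftrightarrow> 2 ^ m dvd a" for m :: nat
      proof (cases "m \<le> Suc k")
        case True
        then show ?thesis by (simp add: dvd_add_left_iff le_imp_power_dvd del: power_Suc)
      next
        case False
        then have pow: "(2::int) ^ Suc (Suc k) dvd 2 ^ m" by (intro le_imp_power_dvd) simp
        \<comment> \<open>Both \<open>a\<close> and \<open>a + 2 ^ Suc k\<close> lie strictly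
          between 0 and \<open>2 ^ (k + 2)\<close>.\<close>
        have "\<not> 2 ^ Suc (Suc k) dvd a + 2 ^ Suc k" using a by (intro zdvd_not_zless) auto
        moreover have "\<not> 2 ^ Suc (Suc k) dvd a" using a by (intro zdvd_not_zless) auto
        ultimately show ?thesis using pow dvd_trans by blast
      qed
      then show ?thesis by (simp add: multiplicity_def)
    qed
    show "multiplicity 2 (H + (along i x + along j y) l + t l) = multiplicity 2 (H + 0 l + t l)"
      using val[OF h] xy ij(3) by (auto simp: along_simps ac_simps)
  qed
  also have "\<dots> = tiling n k (center + 0 + t)"
    by (rule tile[symmetric]) (auto simp: lattice_Z_def)
  finally show "tiling n k (center + along i x + along j y + t) = tiling n k (center + t)"
    by (simp add: add.assoc)
qed (use ij in \<open>auto intro!: lattice_Z_add along_lattice_Z center_lattice_Z\<close>)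

text \<open>The translations by \<open>- (2 * H + 1)\<close> and by \<open>2 * H\<close> differ by
  the period \<open>p\<close>.\<close>

lemma f_center_back:
  assumes ij: "i < n" "j < n" "i \<noteq> j" and y: "y \<in> {0, 2 * H}"
  shows "f (center + along i (- (2 * H + 1)) + along j y) = f center"
proof -
  let ?u = "center + along i (- (2 * H + 1)) + along j y"
  have "f (?u + along i p) = f ?u"
  proof (rule f_periodic_p[OF _ ij(1)])
    show "?u \<in> lattice_Z n" using ij by (intro lattice_Z_add along_lattice_Z center_lattice_Z)
    show "- 8 * N + r \<le> ?u l \<and> ?u l + r < 0" if "l < n" for l
      using that sizes(5) r y ij(3) by (auto simp: along_simps center_def)
    show "?u i + p + r < 0" using ij sizes(2,5) r y by (auto simp: along_simps center_def)
  qed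
  moreover have eq: "?u + along i p = center + along i (2 * H) + along j y"
    by (auto simp: along_def fun_eq_iff sizes(2))
  ultimately show ?thesis using f_center_shift[OF ij _ y, of "2 * H"] unfolding eq by simp
qed

text \<open>A zigzag with \<open>2 * H\<close> teeth would end at a position whose window equals
  that of its start, against \<open>zigzag\<close>.\<close>

lemma not_parallel:
  assumes ij: "i < n" "j < n" "i \<noteq> j"
  shows "step j center \<noteq> step i center" "step j center \<noteq> - step i center"
proof -
  let ?M = "2 * 2 ^ k :: nat"
  have M: "int ?M = 2 * H" "- int (Suc ?M) = - (2 * H + 1)" by simp_all
  have w: "step i center \<in> gens d" by (intro step center_lattice_Z ij)
  have RN: "int ?M + 1 \<le> N" using sizes(1,5) M by linarith
  show "step j center \<noteq> step i center"
  proof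
    assume par: "step j center = step i center"
    have "f (center + along i (- int (Suc ?M)) + along j (if True then int ?M else - int ?M)) \<noteq> f center"
      by (rule zigzag[OF center_lattice_Z ij(1,2) w, where R = N])
        (use step_plane[OF ij] ij par RN in auto)
    then show False using f_center_back[OF ij, of "2 * H"] unfolding M by simp
  qed
  show "step j center \<noteq> - step i center"
  proof
    assume par: "step j center = - step i center"
    \<comment> \<open>With antiparallel steps the zigzag descends in direction \<open>j\<close>, so
      it starts at the copy raised by \<open>2 * H\<close> and ends level with the center.\<close>
    let ?a = "center + along j (2 * H)"
    have "step l (?a + along i x + along j y) = step l center"
      if "\<bar>x\<bar> \<le> 2 * H + 1" "\<bar>y\<bar> \<le> 2 * H + 1" "l < n" for l x y
    proof -
      have eq: "?a + along i x + along j y = center + along i x + along j (2 * H + y)"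
        by (simp add: along_add ac_simps)
      have "\<bar>x\<bar> \<le> N" "\<bar>2 * H + y\<bar> \<le> N" using that(1,2) sizes(1,5) by linarith+
      then show ?thesis unfolding eq by (rule step_plane[OF ij that(3)])
    qed
    then have "f (?a + along i (- int (Suc ?M)) + along j (if False then int ?M else - int ?M)) \<noteq> f ?a"
      by (intro zigzag[OF _ ij(1,2) w, where R = "2 * H + 1"])
        (use ij par in \<open>auto intro!: lattice_Z_add along_lattice_Z center_lattice_Z\<close>)
    moreover have eq: "?a + along i (- int (Suc ?M)) + along j (if False then int ?M else - int ?M) =
        center + along i (- (2 * H + 1)) + along j 0"
      by (auto simp: along_def fun_eq_iff)
    ultimately show False
      using f_center_back[OF ij, of 0] f_center_shift[OF ij, of 0 "2 * H"]
      unfolding eq by (simp add: along_0)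
  qed
qed

text \<open>Each direction moves the net along one of \<open>d\<close> axes, and by
  \<open>not_parallel\<close> distinct directions use distinct axes.\<close>

lemma dimension_le: "n \<le> d"
proof (rule ccontr)
  assume "\<not> n \<le> d"
  have "\<forall>i\<in>{..<n}. \<exists>a\<in>{..<d}. step i center = unit_vec a \<or> step i center = - unit_vec a"
    using step(1)[OF center_lattice_Z] by (auto simp: gens_def)
  then obtain ax where ax: "\<And>i. i < n \<Longrightarrow> ax i < d"
    "\<And>i. i < n \<Longrightarrow> step i center = unit_vec (ax i) \<or> step i center = - unit_vec (ax i)"
    by (metis lessThan_iff)
  have "\<not> inj_on ax {..<n}"
    using \<open>\<not> n \<le> d\<close> ax(1) card_inj_on_le[of ax "{..<n}" "{..<d}"] by auto
  then obtain i j where ij: "i < n" "j < n" "i \<noteq> j" "ax i = ax j" by (auto simp: inj_on_def)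
  then show False using not_parallel[OF ij(1-3)] ax(2)[OF ij(1)] ax(2)[OF ij(2)] by auto
qed

end

text \<open>The order of choices matters: the radii \<open>s\<close> work for every
  \<open>k\<close>, they determine the window radius \<open>r\<close>, and only then is
  \<open>k\<close> taken large enough for \<open>r < 2 ^ k\<close>.\<close>

theorem M_graph_not_in_HH:
  assumes d: "d \<ge> 1" and L: "L \<ge> 4" and dn: "n > d"
  shows "M_graph d L \<notin> HH n"
proof
  assume "M_graph d L \<in> HH n"
  then obtain c where c: "c \<in> Free n \<rightarrow> M_verts d L" "finitary n c"
    "\<And>x i. x \<in> Free n \<Longrightarrow> i < n \<Longrightarrow> (c x, c (shift n (unit_vec i) x)) \<in> parcs (M_graph d L)"
    unfolding HH_iff_finitary pverts_M_graph by blast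
  have n2: "n \<ge> 2" using d dn by simp
  have "\<forall>g. \<exists>s. g \<in> lattice_Z n \<longrightarrow> g \<noteq> 0 \<longrightarrow>
      (\<forall>k. \<forall>v\<in>lattice_Z n. \<exists>t\<in>cube n s. tiling n k (v + t + g) \<noteq> tiling n k (v + t))"
    using tiling_uniformly_aperiodic[OF n2] by blast
  then obtain s where s: "\<And>g k v. g \<in> lattice_Z n \<Longrightarrow> g \<noteq> 0 \<Longrightarrow> v \<in> lattice_Z n \<Longrightarrow>
      \<exists>t\<in>cube n (s g). tiling n k (v + t + g) \<noteq> tiling n k (v + t)"
    by metis
  have tiling: "aperiodic_within n s (shift n u (tiling n k))" if "u \<in> lattice_Z n" for u k
    by (rule aperiodic_within_shift[OF _ that])
      (use s in \<open>simp add: aperiodic_within_def tiling_extensional\<close>)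
  obtain r where r: "r \<ge> 0" "\<forall>x y. aperiodic_within n s x \<longrightarrow> y \<in> Free n \<longrightarrow>
      (\<forall>u\<in>cube n r. y u = x u) \<longrightarrow> c y = c x"
    using uniform_window[OF c(2)] by blast
  define k where "k = nat r"
  have "int k < 2 ^ k" using of_nat_less_two_power[of k] by simp
  then have k: "r < 2 ^ k" using r(1) by (simp add: k_def)
  interpret tiled_walk d n L "\<lambda>u. c (shift n u (tiling n k))" k r
  proof
    show "d \<ge> 1" "L \<ge> 4" "n \<ge> 2" "0 \<le> r" "r < 2 ^ k" by fact+
    show "c (shift n u (tiling n k)) \<in> M_verts d L" if "u \<in> lattice_Z n" for u
      using c(1) aperiodic_within_Free[OF tiling[OF that]] by blast
    show "(c (shift n u (tiling n k)), c (shift n (u + unit_vec i) (tiling n k))) \<in> parcs (M_graph d L)"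
      if "u \<in> lattice_Z n" "i < n" for u i
      using c(3)[OF aperiodic_within_Free[OF tiling[OF that(1)]] that(2)] that(2)
      by (simp add: shift_shift lattice_Z_unit_vec add.commute)
    show "c (shift n u (tiling n k)) = c (shift n u' (tiling n k))"
      if u: "u \<in> lattice_Z n" "u' \<in> lattice_Z n"
        and eq: "\<And>t. t \<in> cube n r \<Longrightarrow> tiling n k (u + t) = tiling n k (u' + t)" for u u'
    proof (rule r(2)[rule_format])
      fix t assume t: "t \<in> cube n r"
      then have "t \<in> lattice_Z n" using cube_subset_lattice_Z by blast
      then show "shift n u (tiling n k) t = shift n u' (tiling n k) t"
        using eq[OF t] by (simp add: shift_apply add.commute)
    qed (use u in \<open>auto intro: aperiodic_within_Free tiling\<close>)
  qed
  show False using dimension_le dn by simp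
qed

theorem proposition7p7:
  shows "(\<forall>d\<ge>1. \<forall>L\<ge>4. M_graph d L \<in> HH d - HH (d + 1)) \<and>
    (infinite (UNIV :: 'a set) \<longrightarrow>
      (\<forall>d\<ge>1. (HH (d + 1) :: 'a pair_pre_digraph set) \<subset> HH d))"
proof (intro conjI allI impI)
  show M: "M_graph d L \<in> HH d - HH (d + 1)" if "d \<ge> 1" "L \<ge> 4" for d L
    using that M_graph_in_HH[of d L] M_graph_not_in_HH[of d L "d + 1"] by simp
  fix d :: nat
  assume inf: "infinite (UNIV :: 'a set)" and d: "d \<ge> 1"
  have graph: "pair_graph (M_graph d 4)" using pair_graph_M_graph[OF d] by simp
  then have "finite (pverts (M_graph d 4))"
    by (meson pair_graph.axioms(1) pair_digraph.axioms(1) pair_fin_digraph.pair_finite_verts)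
  moreover obtain B :: "'a set" where "finite B" "card B = card (pverts (M_graph d 4))"
    using infinite_arbitrarily_large[OF inf] by blast
  \<comment> \<open>An infinite vertex type has room for an injective copy of
    \<open>M_graph d 4\<close>, and this copy witnesses strictness.\<close>
  ultimately obtain h :: "(nat \<Rightarrow> int) set \<Rightarrow> 'a" where h: "inj_on h (pverts (M_graph d 4))"
    using finite_same_card_bij bij_betw_imp_inj_on by metis
  have "image_graph h (M_graph d 4) \<in> HH d - HH (d + 1)"
    using M[OF d, of 4] image_graph_in_HH_iff[OF graph h] by simp
  then show "(HH (d + 1) :: 'a pair_pre_digraph set) \<subset> HH d"
    using HH_Suc_subset[of d] by auto
qed

end
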